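(* Let $n\geq 5$ be an integer, let $S_n$ be the symmetric group on $n$ letters, and let $N$ be a group of order $n!$ with $e(S_n,N)\geq 1$. Then at least one of the following holds: (1) $N$ fits into a short exact sequence $1\longrightarrow A_n\longrightarrow N\longrightarrow\{\pm1\}\longrightarrow 1$; (2) $N$ fits into a short exact sequence $1\longrightarrow\{\pm1\}\longrightarrow N\longrightarrow A_n\longrightarrow 1$; (3) $S_n$ embeds into $\mathrm{Out}(N)$. Moreover, for any proper maximal characteristic subgroup $M$ of $N$, the quotient $N/M$ is either non-abelian or isomorphic to $\{\pm1\}$.
   Context: All groups are finite. $A_n$ is the alternating group on $n$ letters and $\mathrm{Out}(N)=\mathrm{Aut}(N)/\mathrm{Inn}(N)$ is the outer automorphism group. A subgroup $M$ of $N$ is characteristic if $\varphi(M)=M$ for all $\varphi\in\mathrm{Aut}(N)$; a proper maximal characteristic subgroup is a characteristic subgroup $M\ne N$ that is maximal (under inclusion) among the characteristic subgroups of $N$ different from $N$. For a group $G$, $\mathrm{Perm}(G)$ denotes the symmetric group on the underlying set of $G$. The left regular representation is $\lambda:G\to\mathrm{Perm}(G)$, $\lambda(\sigma)=(\tau\mapsto\sigma\tau)$. A subgroup $R$ of $\mathrm{Perm}(G)$ is called regular if the map $R\to G$, $\eta\mapsto\eta(1_G)$, is bijective. For groups $G,N$ of the same order, $e(G,N)$ denotes the number of regular subgroups of $\mathrm{Perm}(G)$ which are isomorphic to $N$ and normalized by $\lambda(G)$. *)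

theory Defs
  imports "HOL-Algebra.Algebra" "HOL-Algebra.Sym_Groups" "HOL-Algebra.Group_Action"
begin

(* Automorphisms are the extensional ones of HOL-Algebra (auto, AutoGroup), hence the bounded
   abstraction. *)
definition inner_auto :: "('a, 'b) monoid_scheme \<Rightarrow> ('a \<Rightarrow> 'a) set"
  where "inner_auto G =
    (\<lambda>g. \<lambda>x \<in> carrier G. g \<otimes>\<^bsub>G\<^esub> x \<otimes>\<^bsub>G\<^esub> inv\<^bsub>G\<^esub> g) ` carrier G"

definition OutGroup :: "('a, 'b) monoid_scheme \<Rightarrow> ('a \<Rightarrow> 'a) set monoid"
  where "OutGroup G = AutoGroup G Mod inner_auto G"

definition characteristic :: "'a set \<Rightarrow> ('a, 'b) monoid_scheme \<Rightarrow> bool"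
  where "characteristic M G \<longleftrightarrow> subgroup M G \<and> (\<forall>\<phi> \<in> auto G. \<phi> ` M = M)"

definition maximal_characteristic :: "'a set \<Rightarrow> ('a, 'b) monoid_scheme \<Rightarrow> bool"
  where "maximal_characteristic M G \<longleftrightarrow>
    characteristic M G \<and> M \<noteq> carrier G \<and>
    (\<forall>K. characteristic K G \<and> K \<noteq> carrier G \<and> M \<subseteq> K \<longrightarrow> K = M)"

definition left_regular :: "('a, 'b) monoid_scheme \<Rightarrow> 'a \<Rightarrow> ('a \<Rightarrow> 'a)"
  where "left_regular G \<sigma> = (\<lambda>\<tau> \<in> carrier G. \<sigma> \<otimes>\<^bsub>G\<^esub> \<tau>)"

(* Perm(G) is BijGroup (carrier G). *)
definition regular_subgroup :: "('a \<Rightarrow> 'a) set \<Rightarrow> ('a, 'b) monoid_scheme \<Rightarrow> bool"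
  where "regular_subgroup R G \<longleftrightarrow>
    subgroup R (BijGroup (carrier G)) \<and> bij_betw (\<lambda>\<eta>. \<eta> \<one>\<^bsub>G\<^esub>) R (carrier G)"

(* The number e(G,N); for finite G the counted set is finite, so card is its true cardinality. *)
definition num_regular ::
    "('a, 'b) monoid_scheme \<Rightarrow> ('c, 'd) monoid_scheme \<Rightarrow> nat"
  where "num_regular G N = card {R. regular_subgroup R G \<and>
    (BijGroup (carrier G))\<lparr>carrier := R\<rparr> \<cong> N \<and>
    left_regular G ` carrier G \<subseteq> normalizer (BijGroup (carrier G)) R}"

(* 1 \<longrightarrow> A \<longrightarrow> E \<longrightarrow> B \<longrightarrow> 1 is exact for some choice of maps. The library's exact_seq would force
   A, E, B to have one common element type. *)
definition fits_short_exact ::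
    "('a, 'd) monoid_scheme \<Rightarrow> ('b, 'e) monoid_scheme \<Rightarrow> ('c, 'f) monoid_scheme \<Rightarrow> bool"
  where "fits_short_exact A E B \<longleftrightarrow>
    (\<exists>f g. f \<in> mon A E \<and> g \<in> epi E B \<and> f ` carrier A = kernel E B g)"

definition embeds :: "('a, 'c) monoid_scheme \<Rightarrow> ('b, 'd) monoid_scheme \<Rightarrow> bool"
  where "embeds G H \<longleftrightarrow> (\<exists>f. f \<in> mon G H)"

end

theory Submission
  imports Defs "HOL-Number_Theory.Cong"
begin

text \<open>Let \<open>R\<close> be a regular subgroup of \<open>Perm(G)\<close>, isomorphic to \<open>N\<close> and normalized by \<open>\<lambda>(G)\<close>. Conjugation by
\<open>\<lambda>(\<sigma>)\<close> is an automorphism \<open>f \<sigma>\<close> of \<open>R\<close>, and regularity labels the elements of \<open>R\<close> by those of \<open>G\<close>. The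
labelling, after an inversion, is a bijective crossed homomorphism \<open>g\<close>, that is
\<open>g (\<sigma> \<tau>) = g \<sigma> \<cdot> f \<sigma> (g \<tau>)\<close>. Everything below is about such pairs \<open>(f, g)\<close> for \<open>G = S\<^sub>n\<close>.

For the trichotomy, consider \<open>S\<^sub>n \<rightarrow> Out(N)\<close>. As \<open>n \<ge> 5\<close>, its kernel is trivial, so that \<open>S\<^sub>n\<close> embeds into \<open>Out(N)\<close>, or
contains \<open>A\<^sub>n\<close>, so that \<open>f\<close> maps \<open>A\<^sub>n\<close> into \<open>Inn(N)\<close>. If \<open>f\<close> is not injective, it is trivial on \<open>A\<^sub>n\<close>,
where \<open>g\<close> is then an injective homomorphism, and its image has index 2 in \<open>N\<close>. If \<open>f\<close> is injective,
\<open>|A\<^sub>n|\<close> divides \<open>|Inn(N)|\<close>, so the centre of \<open>N\<close> has order 1 or 2; in the first case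
\<open>A\<^sub>n\<close> embeds in \<open>Inn(N)\<close>, hence in \<open>N\<close>, with index 2, and in the second \<open>Inn(N)\<close> is a copy of \<open>A\<^sub>n\<close>,
so that \<open>N\<close> is an extension of \<open>A\<^sub>n\<close> by its centre of order 2.

For the quotients, a characteristic subgroup \<open>M\<close> turns \<open>(f, g)\<close> into a surjective crossed homomorphism onto
\<open>V = N/M\<close>, and the claim becomes: an abelian such \<open>V\<close> has at most two elements
(\<open>abelian_cocycle_card_le_2\<close>). A power map reduces this to \<open>|V| = p\<^sup>m\<close>. The group \<open>S\<^sub>n\<close> acts on
\<open>V\<close> by the affine maps \<open>v \<mapsto> g \<sigma> \<cdot> f \<sigma> v\<close>, transitively, and the stabilizer \<open>H\<close> of the identity of \<open>V\<close>
has index \<open>p\<^sup>m\<close>. The main step is that \<open>H\<close> is transitive on \<open>{1..n}\<close>. Otherwise some binomial coefficient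
\<open>n choose a\<close> with \<open>0 < a < n\<close> is a power of \<open>p\<close>, which forces \<open>a = 1\<close> or \<open>a = n - 1\<close>; hence \<open>H\<close> fixes a point
and \<open>p\<close> divides \<open>n\<close>. A transposition (for odd \<open>p\<close>) or a 3-cycle (for \<open>p = 2\<close>) then has a number of fixed points on \<open>V\<close>
that is a power of \<open>p\<close> and also a multiple of \<open>n - 2\<close> or \<open>n - 3\<close>, which is a contradiction.

Transitivity of \<open>H\<close> means that already the permutations fixing \<open>n\<close>, a symmetric group on \<open>n - 1\<close> letters, map onto \<open>V\<close>. Repeating this down to \<open>S\<^sub>4\<close> shows that \<open>|V|\<close> divides 24,
so \<open>V\<close> is too small for a 5-cycle to act on it nontrivially. Hence \<open>f\<close> is trivial on \<open>A\<^sub>n\<close>, so \<open>g\<close> restricts to a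
homomorphism from the perfect group \<open>A\<^sub>n\<close> to an abelian group, and \<open>g\<close> takes at most two values.\<close>

section \<open>Normal subgroups of symmetric groups\<close>

lemma conj_transpose:
  assumes "bij p"
  shows "p \<circ> transpose a b \<circ> inv' p = transpose (p a) (p b)"
proof
  fix x
  obtain y where "x = p y" using assms by (metis bij_pointE)
  then show "(p \<circ> transpose a b \<circ> inv' p) x = transpose (p a) (p b) x"
    using assms by (simp add: transpose_def bij_is_inj inj_eq)
qed

lemma permutes_onto_triple:
  assumes "x \<in> S" "y \<in> S" "z \<in> S" "distinct [x, y, z]"
    and "a \<in> S" "b \<in> S" "c \<in> S" "distinct [a, b, c]"
  obtains p where "p permutes S" "p x = a" "p y = b" "p z = c"
proof -
  define y' where "y' = transpose x a y"
  define z' where "z' = transpose y' b (transpose x a z)"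
  define p where "p = transpose z' c \<circ> (transpose y' b \<circ> transpose x a)"
  have "y' \<in> S" "y' \<noteq> a"
    using assms by (auto simp: y'_def transpose_def)
  moreover have "z' \<in> S" "z' \<noteq> a" "z' \<noteq> b"
    using assms calculation by (auto simp: z'_def y'_def transpose_def split: if_splits)
  ultimately have "p permutes S"
    unfolding p_def using assms by (intro permutes_compose permutes_swap_id) auto
  moreover have "p x = a"
    using assms \<open>y' \<noteq> a\<close> \<open>z' \<noteq> a\<close> by (simp add: p_def)
  moreover have "p y = b"
    using assms \<open>z' \<noteq> b\<close> by (simp add: p_def flip: y'_def)
  moreover have "p z = c"
    by (simp add: p_def flip: z'_def)
  ultimately show thesis using that by blast
qed

text \<open>The commutator of a nontrivial permutation with a suitable transposition is a product of two
transpositions. If these are disjoint, multiplying by a conjugate yields a product of two overlapping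
transpositions, which is a 3-cycle. All 3-cycles are conjugate in the symmetric group, and they generate the
alternating group.\<close>

theorem normal_subgroup_contains_alt_group:
  assumes "n \<ge> 5" and "H \<lhd> sym_group n" and "H \<noteq> {id}"
  shows "carrier (alt_group n) \<subseteq> H"
proof -
  interpret H: normal H "sym_group n" by fact
  have H_perm: "p permutes {1..n}" if "p \<in> H" for p
    using that H.subset sym_group_carrier by blast
  have H_comp: "p \<circ> q \<in> H" if "p \<in> H" "q \<in> H" for p q
    using subgroup.m_closed[OF H.subgroup_axioms that] by (simp add: sym_group_mult)
  have H_inv: "inv' p \<in> H" if "p \<in> H" for p
    using subgroup.m_inv_closed[OF H.subgroup_axioms that] H.subset that by (simp add: subset_iff)
  have H_conj: "q \<circ> p \<circ> inv' q \<in> H" if "p \<in> H" "q permutes {1..n}" for p q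
    using H.inv_op_closed2[of q p] that by (simp add: sym_group_carrier sym_group_mult)
  obtain p where p: "p \<in> H" "p \<noteq> id"
    using assms(3) subgroup.one_closed[OF H.subgroup_axioms] by (auto simp: sym_group_one)
  obtain a where a: "p a \<noteq> a" using p(2) by (auto simp: fun_eq_iff)
  define b where "b = p a"
  have aS: "a \<in> {1..n}" using a H_perm[OF p(1)] by (meson permutes_not_in)
  have bS: "b \<in> {1..n}" using aS permutes_in_image[OF H_perm[OF p(1)]] by (simp add: b_def)
  have fresh: "\<exists>c\<in>{1..n}. c \<notin> set xs" if "length xs \<le> 4" for xs
  proof (rule ccontr)
    assume "\<not> ?thesis"
    then have "{1..n} \<subseteq> set xs" by blast
    from card_mono[OF _ this] have "n \<le> card (set xs)" by simp
    then show False using that assms(1) card_length[of xs] by linarith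
  qed
  obtain c where c: "c \<in> {1..n}" "c \<notin> {a, b}"
    using fresh[of "[a, b]"] by auto
  define d where "d = p c"
  have dS: "d \<in> {1..n}" using c permutes_in_image[OF H_perm[OF p(1)]] by (simp add: d_def)
  have bd: "b \<noteq> d"
    using c permutes_inj[OF H_perm[OF p(1)]] by (auto simp: b_def d_def inj_eq)
  have tac: "transpose a c permutes {1..n}" using aS c by (intro permutes_swap_id) auto
  have bij_p: "bij p" using permutes_bij[OF H_perm[OF p(1)]] .
  \<comment> \<open>The commutator of \<open>p\<close> with a transposition is a product of two transpositions.\<close>
  have "p \<circ> (transpose a c \<circ> inv' p \<circ> inv' (transpose a c)) \<in> H"
    using p(1) H_inv H_conj tac H_comp by blast
  also have "p \<circ> (transpose a c \<circ> inv' p \<circ> inv' (transpose a c))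
      = transpose b d \<circ> transpose a c"
    using conj_transpose[OF bij_p, of a c] by (simp add: b_def d_def o_assoc)
  finally have pair: "transpose b d \<circ> transpose a c \<in> H" .
  obtain x y z where xyz: "x \<in> {1..n}" "y \<in> {1..n}" "z \<in> {1..n}" "distinct [x, y, z]"
    and xyzH: "transpose x y \<circ> transpose y z \<in> H"
  proof (cases "d = a \<or> d = c")
    case True
    then show thesis
    proof
      assume "d = a"
      then show thesis using that[of b a c] pair aS bS c a by (auto simp: b_def)
    next
      assume "d = c"
      then show thesis using that[of b c a] pair aS bS c a
        by (auto simp: b_def transpose_commute)
    qed
  next
    case False
    \<comment> \<open>This is where a fifth point is needed: \<open>(b d)(a c)\<close> times its conjugate \<open>(b d)(a e)\<close> is a 3-cycle.\<close>
    obtain e where e: "e \<in> {1..n}" "e \<notin> {a, b, c, d}"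
      using fresh[of "[a, b, c, d]"] by auto
    have bij: "bij (transpose c e)" by simp
    have "transpose c e \<circ> (transpose b d \<circ> transpose a c) \<circ> inv' (transpose c e) \<in> H"
      using pair c e by (intro H_conj permutes_swap_id) auto
    also have "transpose c e \<circ> (transpose b d \<circ> transpose a c) \<circ> inv' (transpose c e)
      = (transpose c e \<circ> transpose b d \<circ> inv' (transpose c e)) \<circ> (transpose c e \<circ> transpose a c \<circ> inv' (transpose c e))"
      by (simp add: fun_eq_iff)
    also have "\<dots> = transpose b d \<circ> transpose a e"
      unfolding conj_transpose[OF bij] using c e False a by (auto simp: b_def)
    finally have "(transpose b d \<circ> transpose a c) \<circ> (transpose b d \<circ> transpose a e) \<in> H"
      using pair H_comp by blast
    also have "(transpose b d \<circ> transpose a c) \<circ> (transpose b d \<circ> transpose a e)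
      = transpose c a \<circ> transpose a e"
      using c e False a bd by (auto simp: fun_eq_iff transpose_def b_def)
    finally show thesis using that[of c a e] aS c e by (auto simp: comp_def)
  qed
  have "three_cycles n \<subseteq> H"
  proof
    fix q assume "q \<in> three_cycles n"
    then obtain cs where cs: "q = cycle_of_list cs" "cycle cs" "length cs = 3" "set cs \<subseteq> {1..n}"
      by auto
    obtain i j k where ijk: "cs = [i, j, k]" using stupid_lemma[OF cs(3)] by blast
    obtain r where r: "r permutes {1..n}" "r x = i" "r y = j" "r z = k"
      using permutes_onto_triple[of x "{1..n}" y z i j k] xyz cs(2,4) unfolding ijk by auto
    have bij: "bij r" using permutes_bij[OF r(1)] .
    have "r \<circ> (transpose x y \<circ> transpose y z) \<circ> inv' r
      = (r \<circ> transpose x y \<circ> inv' r) \<circ> (r \<circ> transpose y z \<circ> inv' r)"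
      using bij by (simp add: fun_eq_iff bij_is_inj)
    also have "\<dots> = q"
      unfolding conj_transpose[OF bij] r cs(1) ijk by simp
    finally show "q \<in> H" using H_conj[OF xyzH r(1)] by simp
  qed
  then have "generate (sym_group n) (three_cycles n) \<subseteq> H"
    using group.generate_subgroup_incl[OF sym_group_is_group] H.subgroup_axioms by blast
  moreover have "carrier (alt_group n) = generate (sym_group n) (three_cycles n)"
    using group.generate_consistent[OF sym_group_is_group three_cycles_incl alt_group_is_subgroup]
      alt_group_carrier_as_three_cycles[of n] by (simp add: alt_group_def)
  ultimately show ?thesis by simp
qed

section \<open>Binomial coefficients that are prime powers, and counting fixed points\<close>

hide_const (open) Divisibility.prime

text \<open>Every common multiple of the \<open>k\<close> consecutive numbers from \<open>n - k + 1\<close> to \<open>n\<close> is a multiple of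
\<open>k * (n choose k)\<close>. In the induction, \<open>L\<close> is a multiple both of \<open>k * (n choose k)\<close> and of
\<open>k * ((n - 1) choose k)\<close>; the difference of the two cofactors is the cofactor for \<open>k + 1\<close>.\<close>

lemma mult_binomial_dvd:
  fixes L :: nat
  assumes "k \<ge> 1" "k \<le> n" and "\<And>i. \<lbrakk>n - k < i; i \<le> n\<rbrakk> \<Longrightarrow> i dvd L"
  shows "k * (n choose k) dvd L"
  using assms
proof (induction k arbitrary: n rule: nat_induct_at_least)
  case base
  then show ?case by simp
next
  case (Suc k)
  have "k * (n choose k) dvd L"
    using Suc.prems by (intro Suc.IH) auto
  then obtain u where u: "L = k * (n choose k) * u" by (elim dvdE)
  have "k * ((n - 1) choose k) dvd L"
    using Suc.prems by (intro Suc.IH) auto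
  then obtain v where v: "L = k * ((n - 1) choose k) * v" by (elim dvdE)
  define C where "C = (n - 1) choose k"
  have C: "n * C = (n - k) * (n choose k)"
    using binomial_absorb_comp[of n k] by (simp add: C_def)
  have pos: "C > 0" "n choose k > 0" using Suc.prems by (auto simp: C_def)
  have k: "k \<ge> 1" "k < n" using Suc by auto
  have "(n choose k) * u = C * v"
    using u v k by (simp add: C_def)
  then have "n * (n choose k) * u = (n * C) * v" by (simp add: ac_simps)
  then have "n * (n choose k) * u = (n - k) * (n choose k) * v" using C by simp
  then have nu: "n * u = (n - k) * v" using pos by (simp add: ac_simps)
  have uv: "int (n - k) * (int v - int u) = int k * int u"
    using nu k by (simp add: algebra_simps of_nat_diff flip: of_nat_mult)
  \<comment> \<open>The cofactor \<open>v - u\<close> is written over the integers, where the subtraction does not truncate.\<close>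
  have "int L = int (Suc k * (n choose Suc k)) * (int v - int u)"
  proof -
    have "Suc k * (n choose Suc k) = (n - k) * (n choose k)"
      using C binomial_absorption[of k n] by (simp add: C_def)
    then have "int (Suc k * (n choose Suc k)) * (int v - int u)
        = int (n choose k) * (int (n - k) * (int v - int u))"
      by (simp add: ac_simps)
    then show ?thesis using u uv by (simp add: ac_simps)
  qed
  then have "int (Suc k * (n choose Suc k)) dvd int L" by (metis dvd_triv_left)
  then show ?case by (simp only: int_dvd_int_iff)
qed

text \<open>The number \<open>L\<close> below is a common multiple of \<open>1, \<dots>, n\<close> whose \<open>p\<close>-part is the largest power of \<open>p\<close> that is
at most \<open>n\<close>. By the preceding lemma it is a multiple of the binomial coefficient.\<close>

lemma prime_power_binomial_le:
  assumes p: "prime p" and "k \<ge> 1" "k \<le> n" and dvd: "p ^ j dvd (n choose k)"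
  shows "p ^ j \<le> n"
proof -
  define e where "e = Max {i. p ^ i \<le> n}"
  have p2: "p \<ge> 2" using p prime_ge_2_nat by blast
  have fin: "finite {i. p ^ i \<le> n}"
  proof (rule finite_subset)
    show "{i. p ^ i \<le> n} \<subseteq> {..n}"
    proof
      fix i assume "i \<in> {i. p ^ i \<le> n}"
      moreover have "i < p ^ i" using p2 by (intro power_gt_expt) auto
      ultimately show "i \<in> {..n}" by simp
    qed
  qed simp
  have "0 \<in> {i. p ^ i \<le> n}" using assms by simp
  then have e: "p ^ e \<le> n" using Max_in[OF fin] unfolding e_def by blast
  have le_e: "i \<le> e" if "p ^ i \<le> n" for i
    using Max_ge[OF fin] that unfolding e_def by blast
  define q where "q i = i div p ^ multiplicity p i" for i
  have split: "i = p ^ multiplicity p i * q i" for i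
    unfolding q_def by (simp add: multiplicity_dvd)
  have q: "coprime p (q i)" if "i \<ge> 1" for i
    using that p unfolding q_def
    by (metis multiplicity_decompose not_is_unit_0 not_one_le_zero prime_imp_coprime zero_neq_one not_prime_unit One_nat_def)
  define L where "L = p ^ e * (\<Prod>i=1..n. q i)"
  have "i dvd L" if "n - k < i" "i \<le> n" for i
  proof -
    have i: "i \<ge> 1" using that by simp
    have "p ^ multiplicity p i \<le> i" using i by (intro dvd_imp_le multiplicity_dvd) auto
    then have "p ^ multiplicity p i dvd p ^ e"
      using le_e[of "multiplicity p i"] that by (intro le_imp_power_dvd) simp
    moreover have "q i dvd (\<Prod>i=1..n. q i)" using i that by (intro dvd_prodI) auto
    ultimately show "i dvd L"
      unfolding L_def by (subst split) (rule mult_dvd_mono)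
  qed
  then have "k * (n choose k) dvd L" using assms by (intro mult_binomial_dvd)
  then have "p ^ j dvd L" using dvd by (meson dvd_mult_right dvd_trans)
  moreover have "coprime (p ^ j) (\<Prod>i=1..n. q i)"
    by (intro prod_coprime_right) (use q in auto)
  ultimately have "p ^ j dvd p ^ e"
    unfolding L_def by (simp add: coprime_dvd_mult_left_iff)
  then show ?thesis using e p2 by (meson dvd_imp_le le_trans zero_less_power less_le_trans zero_less_numeral)
qed

text \<open>For \<open>2 \<le> k \<le> n - 2\<close> the binomial coefficient is at least \<open>n choose 2\<close>, which exceeds \<open>n\<close> once \<open>n \<ge> 4\<close>; by the
preceding bound it is then not a prime power.\<close>

lemma binomial_prime_power_imp:
  assumes p: "prime p" and n: "n \<ge> 5" and k: "0 < k" "k < n" and eq: "n choose k = p ^ j"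
  shows "k = 1 \<or> k = n - 1"
proof (rule ccontr)
  assume neg: "\<not> ?thesis"
  have le: "n choose k \<le> n"
    using prime_power_binomial_le[OF p, of k n j] k eq by simp
  define l where "l = min k (n - k)"
  have l: "2 \<le> l" "2 * l \<le> n" using neg k by (auto simp: l_def)
  have "n choose l = n choose k"
    using k binomial_symmetric[of k n] by (auto simp: l_def min_def)
  moreover have "n choose 2 \<le> n choose l"
    using l by (intro binomial_mono) auto
  moreover have "n choose 2 > n"
  proof -
    have "4 * n \<le> (n - 1) * n" using n by (intro mult_right_mono) auto
    then have "4 * n \<le> n * (n - 1)" by (simp only: mult.commute)
    then have "2 * n \<le> n * (n - 1) div 2" by linarith
    then show ?thesis using n unfolding choose_two by linarith
  qed
  ultimately show False using le by simp
qed

text \<open>The orbits of a permutation of prime order \<open>r\<close> have 1 or \<open>r\<close> elements. The induction removes one orbit of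
size \<open>r\<close> at a time.\<close>

lemma card_cong_card_fixed_points:
  fixes r :: nat
  assumes r: "prime r" and fin: "finite U"
    and closed: "\<And>x. x \<in> U \<Longrightarrow> t x \<in> U"
    and period: "\<And>x. x \<in> U \<Longrightarrow> (t ^^ r) x = x"
  shows "[card U = card {x \<in> U. t x = x}] (mod r)"
  using fin closed period
proof (induction U rule: finite_psubset_induct)
  case (psubset U)
  show ?case
  proof (cases "\<forall>x\<in>U. t x = x")
    case True
    then have "{x \<in> U. t x = x} = U" by blast
    then show ?thesis by simp
  next
    case False
    then obtain x where x: "x \<in> U" "t x \<noteq> x" by blast
    define B where "B = (\<lambda>i. (t ^^ i) x) ` {..<r}"
    have iter: "(t ^^ i) y \<in> U" if "y \<in> U" for y i
      using that psubset.prems(1) by (induction i) auto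
    have tr: "(t ^^ r) x = x" using psubset.prems(2) x by blast
    have mult: "(t ^^ (i * m)) y = y" if "(t ^^ m) y = y" for i m y
      using that by (induction i) (auto simp: funpow_add)
    have noperiod: "(t ^^ d) x \<noteq> x" if d: "0 < d" "d < r" for d
    proof
      assume eq: "(t ^^ d) x = x"
      have "coprime d r" using d r by (metis coprime_commute nat_dvd_not_less prime_imp_coprime)
      \<comment> \<open>As \<open>d\<close> is invertible modulo \<open>r\<close>, a point of period \<open>d\<close> and of period \<open>r\<close> is a fixed point.\<close>
      then obtain u where "[d * u = 1] (mod r)" using cong_solve_coprime_nat by (metis One_nat_def)
      moreover have "1 mod r = 1" using prime_gt_1_nat[OF r] by simp
      ultimately have "(d * u) mod r = 1" by (simp add: cong_def)
      then obtain w where w: "u * d = w * r + 1"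
        by (metis div_mult_mod_eq mult.commute)
      have "x = (t ^^ (u * d)) x" using mult[OF eq] by simp
      also have "\<dots> = t ((t ^^ (w * r)) x)" unfolding w by simp
      also have "\<dots> = t x" using mult[OF tr] by simp
      finally show False using x by simp
    qed
    have inj: "inj_on (\<lambda>i. (t ^^ i) x) {..<r}"
    proof (rule linorder_inj_onI)
      fix i j assume ij: "i < j" "i \<in> {..<r}" "j \<in> {..<r}"
      show "(t ^^ i) x \<noteq> (t ^^ j) x"
      proof
        assume eq: "(t ^^ i) x = (t ^^ j) x"
        have "(t ^^ (r - j + i)) x = (t ^^ (r - j)) ((t ^^ j) x)"
          by (simp add: funpow_add eq)
        also have "\<dots> = (t ^^ (r - j + j)) x" by (simp only: funpow_add o_apply)
        also have "\<dots> = x" using ij tr by simp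
        finally have "(t ^^ (r - j + i)) x = x" .
        moreover have "(t ^^ (r - j + i)) x \<noteq> x" using ij by (intro noperiod) auto
        ultimately show False by contradiction
      qed
    qed auto
    then have cardB: "card B = r" by (simp add: B_def card_image)
    have BU: "B \<subseteq> U" unfolding B_def using iter x by blast
    have r0: "r > 0" using r prime_gt_0_nat by blast
    have Bx: "x \<in> B" unfolding B_def using r0 by (intro image_eqI[of _ _ 0]) auto
    have tB: "y \<in> B" if "y \<in> U" "t y \<in> B" for y
    proof -
      obtain i where i: "t y = (t ^^ i) x" using \<open>t y \<in> B\<close> by (auto simp: B_def)
      have "y = (t ^^ (r - 1)) (t y)"
        using psubset.prems(2)[OF \<open>y \<in> U\<close>] r0
        by (cases r) (simp_all add: funpow_swap1)
      also have "\<dots> = (t ^^ (r - 1 + i)) x" by (simp add: i funpow_add)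
      also have "\<dots> = (t ^^ ((r - 1 + i) mod r + (r - 1 + i) div r * r)) x"
        by (simp only: mod_div_mult_eq)
      also have "\<dots> = (t ^^ ((r - 1 + i) mod r)) x"
        by (simp only: funpow_add o_apply mult[OF tr])
      finally show "y \<in> B" using r0 by (auto simp: B_def)
    qed
    have nofix: "t y \<noteq> y" if yB: "y \<in> B" for y
    proof
      assume ty: "t y = y"
      obtain i where i: "y = (t ^^ i) x" "i < r" using yB by (auto simp: B_def)
      have fy: "(t ^^ k) y = y" for k using ty by (induction k) auto
      have "(t ^^ (r - i)) y = (t ^^ (r - i + i)) x" by (simp only: i(1) funpow_add o_apply)
      then have "x = (t ^^ (r - i)) y" using tr i(2) by simp
      then have "x = y" using fy by simp
      then show False using ty x by simp
    qed
    have fixU: "{y \<in> U. t y = y} = {y \<in> U - B. t y = y}" using nofix by blast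
    have finU: "finite U" by fact
    have "[card (U - B) = card {y \<in> U - B. t y = y}] (mod r)"
    proof (rule psubset.IH)
      show "U - B \<subset> U" using BU Bx by blast
    next
      fix y assume "y \<in> U - B"
      then show "t y \<in> U - B" "(t ^^ r) y = y" using tB psubset.prems by blast+
    qed
    moreover have "card U = card (U - B) + r"
      using card_Diff_subset[OF finite_subset[OF BU finU] BU] card_mono[OF finU BU] cardB by simp
    ultimately show ?thesis unfolding fixU by (simp add: cong_def)
  qed
qed

lemma card_eq_card_image_times_fibre:
  assumes "finite S" and "\<And>y. y \<in> f ` S \<Longrightarrow> card {x \<in> S. f x = y} = k"
  shows "card S = card (f ` S) * k"
proof -
  have "card S = (\<Sum>x\<in>S. 1)" by simp
  also have "\<dots> = (\<Sum>y\<in>f ` S. \<Sum>x\<in>{x \<in> S. f x = y}. 1)"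
    using sum.image_gen[OF assms(1)] .
  also have "\<dots> = (\<Sum>y\<in>f ` S. k)" using assms(2) by (intro sum.cong) auto
  finally show ?thesis by simp
qed

section \<open>Crossed homomorphisms from a symmetric group\<close>

lemma prime_dvd_of_dvd_prime_power:
  fixes p d m :: nat
  assumes "prime p" "d dvd p ^ m" "1 < d"
  shows "p dvd d"
proof -
  obtain q where "prime q" "q dvd d" using prime_factor_nat[of d] assms(3) by auto
  moreover have "q = p"
    using calculation assms by (metis dvd_trans prime_dvd_power primes_dvd_imp_eq)
  ultimately show ?thesis by simp
qed

lemma permutes_maps_subset_onto:
  assumes "finite S" "A \<subseteq> S" "B \<subseteq> S" "card A = card B"
  obtains p where "p permutes S" "p ` A = B"
proof -
  have fin: "finite A" "finite B" using assms finite_subset by blast+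
  obtain h where h: "bij_betw h A B"
    using finite_same_card_bij[OF fin assms(4)] by blast
  have "card (S - A) = card (S - B)"
    using assms fin by (simp add: card_Diff_subset)
  then obtain h' where h': "bij_betw h' (S - A) (S - B)"
    using finite_same_card_bij[of "S - A" "S - B"] assms(1) by blast
  define p where "p x = (if x \<in> A then h x else if x \<in> S then h' x else x)" for x
  have pA: "bij_betw p A B" using h by (rule bij_betw_cong[THEN iffD1, rotated]) (simp add: p_def)
  moreover have "bij_betw p (S - A) (S - B)"
    using h' by (rule bij_betw_cong[THEN iffD1, rotated]) (simp add: p_def)
  ultimately have "bij_betw p (A \<union> (S - A)) (B \<union> (S - B))"
    by (rule bij_betw_combine) blast
  then have "bij_betw p S S" using assms by (simp add: Un_absorb1)
  then have "p permutes S" by (rule bij_imp_permutes) (use assms in \<open>auto simp: p_def\<close>)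
  then show thesis using that pA by (auto simp: bij_betw_def)
qed

text \<open>A crossed homomorphism \<open>g\<close> from the symmetric group of degree \<open>n\<close> onto \<open>V\<close>, for the action \<open>f\<close>.
The maps \<open>f p\<close> are only assumed to be endomorphisms: that they are bijective and that \<open>f\<close> turns
composition into composition follows from the surjectivity of \<open>g\<close>.\<close>

locale sym_cocycle = group V for V (structure) +
  fixes n :: nat and f :: "(nat \<Rightarrow> nat) \<Rightarrow> 'a \<Rightarrow> 'a" and g :: "(nat \<Rightarrow> nat) \<Rightarrow> 'a"
  assumes f_hom: "p permutes {1..n} \<Longrightarrow> f p \<in> hom V V"
    and g_comp: "\<lbrakk>p permutes {1..n}; q permutes {1..n}\<rbrakk> \<Longrightarrow> g (p \<circ> q) = g p \<otimes> f p (g q)"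
    and g_surj: "g ` {p. p permutes {1..n}} = carrier V"
begin

lemma g_closed: "p permutes {1..n} \<Longrightarrow> g p \<in> carrier V"
  using g_surj by blast

lemma f_closed: "\<lbrakk>p permutes {1..n}; v \<in> carrier V\<rbrakk> \<Longrightarrow> f p v \<in> carrier V"
  using f_hom hom_in_carrier by metis

lemma f_mult:
  "\<lbrakk>p permutes {1..n}; v \<in> carrier V; w \<in> carrier V\<rbrakk> \<Longrightarrow> f p (v \<otimes> w) = f p v \<otimes> f p w"
  using f_hom hom_mult by metis

lemma f_one: "p permutes {1..n} \<Longrightarrow> f p \<one> = \<one>"
  using hom_one[OF f_hom is_group is_group] .

lemma g_obtain:
  assumes "v \<in> carrier V"
  obtains p where "p permutes {1..n}" "v = g p"
  using assms g_surj by blast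

lemma finite_carrier: "finite (carrier V)"
  using finite_permutations[of "{1..n}"] g_surj by (metis finite_atLeastAtMost finite_imageI)

text \<open>Both sides are determined by expanding \<open>g (p \<circ> q \<circ> r)\<close> in two ways, where \<open>v = g r\<close>.\<close>

lemma f_comp:
  assumes p: "p permutes {1..n}" and q: "q permutes {1..n}" and v: "v \<in> carrier V"
  shows "f (p \<circ> q) v = f p (f q v)"
proof -
  obtain r where r: "r permutes {1..n}" "v = g r" using g_obtain[OF v] .
  have "g p \<otimes> f p (g q) \<otimes> f (p \<circ> q) v = g ((p \<circ> q) \<circ> r)"
    using p q r g_comp permutes_compose by metis
  also have "\<dots> = g p \<otimes> f p (g (q \<circ> r))"
    using p q r g_comp permutes_compose by (metis comp_assoc)
  also have "\<dots> = g p \<otimes> f p (g q) \<otimes> f p (f q v)"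
    using p q r by (simp add: g_comp f_mult m_assoc g_closed f_closed)
  finally show ?thesis
    using p q v permutes_compose[OF q p] by (simp add: g_closed f_closed)
qed

lemma g_id: "g id = \<one>"
proof -
  obtain q where q: "q permutes {1..n}" "\<one> = g q" using g_obtain[OF one_closed] .
  have "\<one> = g id \<otimes> f id \<one>"
    using g_comp[OF permutes_id q(1)] by (simp flip: q(2))
  then show ?thesis using f_one[OF permutes_id] g_closed[OF permutes_id] by simp
qed

lemma f_id:
  assumes "v \<in> carrier V"
  shows "f id v = v"
proof -
  obtain q where q: "q permutes {1..n}" "v = g q" using g_obtain[OF assms] .
  then have "v = \<one> \<otimes> f id v" using g_comp[OF permutes_id q(1)] by (simp add: g_id)
  then show ?thesis using f_closed[OF permutes_id assms] by simp
qed

text \<open>The affine action on \<open>V\<close>; with respect to it, \<open>g p\<close> is the image of the identity of \<open>V\<close> under \<open>p\<close>. In particular the action is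
transitive, and \<open>{h. g h = \<one>}\<close> is a point stabilizer.\<close>

definition act :: "(nat \<Rightarrow> nat) \<Rightarrow> 'a \<Rightarrow> 'a"
  where "act p v = g p \<otimes> f p v"

lemma act_closed: "\<lbrakk>p permutes {1..n}; v \<in> carrier V\<rbrakk> \<Longrightarrow> act p v \<in> carrier V"
  by (simp add: act_def g_closed f_closed)

lemma act_g: "\<lbrakk>p permutes {1..n}; q permutes {1..n}\<rbrakk> \<Longrightarrow> act p (g q) = g (p \<circ> q)"
  by (simp add: act_def g_comp)

lemma act_comp:
  assumes p: "p permutes {1..n}" and q: "q permutes {1..n}" and v: "v \<in> carrier V"
  shows "act (p \<circ> q) v = act p (act q v)"
proof -
  obtain r where r: "r permutes {1..n}" "v = g r" using g_obtain[OF v] .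
  then show ?thesis using p q permutes_compose[OF q p] permutes_compose[OF r(1) q]
    by (simp add: act_g comp_assoc)
qed

lemma act_id: "v \<in> carrier V \<Longrightarrow> act id v = v"
  by (simp add: act_def g_id f_id)

lemma act_inv_act:
  assumes "p permutes {1..n}" "v \<in> carrier V"
  shows "act (inv' p) (act p v) = v" "act p (act (inv' p) v) = v"
  using assms act_comp[of "inv' p" p v] act_comp[of p "inv' p" v]
  by (simp_all add: permutes_inv permutes_inv_o act_id)

lemma f_inv_f:
  assumes "p permutes {1..n}" "v \<in> carrier V"
  shows "f (inv' p) (f p v) = v" "f p (f (inv' p) v) = v"
  using assms f_comp[of "inv' p" p v] f_comp[of p "inv' p" v]
  by (simp_all add: permutes_inv permutes_inv_o f_id)

lemma f_bij: "p permutes {1..n} \<Longrightarrow> bij_betw (f p) (carrier V) (carrier V)"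
  by (rule bij_betw_byWitness[where f' = "f (inv' p)"])
    (auto simp: f_inv_f f_closed permutes_inv)

lemma g_eq_iff:
  assumes "p permutes {1..n}" "q permutes {1..n}"
  shows "g p = g q \<longleftrightarrow> g (inv' p \<circ> q) = \<one>"
proof -
  have "g (inv' p \<circ> q) = act (inv' p) (g q)"
    using assms by (simp add: act_g permutes_inv)
  moreover have "\<one> = act (inv' p) (g p)"
    using assms by (simp add: act_g permutes_inv permutes_inv_o g_id)
  moreover have "act (inv' p) (g q) = act (inv' p) (g p) \<longleftrightarrow> g q = g p"
    using assms act_inv_act[of "inv' p"] by (metis g_closed permutes_inv permutes_inv_inv)
  ultimately show ?thesis by metis
qed

text \<open>If an affine map has a fixed point \<open>v\<close>, translation by \<open>v\<close> carries the fixed points of its linear part to its own.\<close>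

lemma card_fixed_points_act:
  assumes p: "p permutes {1..n}" and v: "v \<in> carrier V" "act p v = v"
  shows "card {w \<in> carrier V. act p w = w} = card {w \<in> carrier V. f p w = w}"
proof -
  have shift: "act p (v \<otimes> w) = v \<otimes> f p w" if "w \<in> carrier V" for w
    using that p v by (simp add: act_def f_mult m_assoc[symmetric] g_closed f_closed)
  have "bij_betw (\<lambda>w. v \<otimes> w) {w \<in> carrier V. f p w = w} {w \<in> carrier V. act p w = w}"
  proof (rule bij_betw_byWitness[where f' = "\<lambda>w. inv v \<otimes> w"])
    show "(\<lambda>w. inv v \<otimes> w) ` {w \<in> carrier V. act p w = w} \<subseteq> {w \<in> carrier V. f p w = w}"
    proof (rule image_subsetI)
      fix w assume "w \<in> {w \<in> carrier V. act p w = w}"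
      then have w: "w \<in> carrier V" "act p w = w" by auto
      have "v \<otimes> f p (inv v \<otimes> w) = act p (v \<otimes> (inv v \<otimes> w))" using w v shift by simp
      also have "\<dots> = v \<otimes> (inv v \<otimes> w)" using w v by (simp add: m_assoc[symmetric])
      finally show "inv v \<otimes> w \<in> {w \<in> carrier V. f p w = w}"
        using w v p by (simp add: f_closed)
    qed
  qed (use v shift in \<open>auto simp: m_assoc[symmetric]\<close>)
  then show ?thesis by (simp add: bij_betw_same_card)
qed

lemma card_fixed_points_f_dvd:
  assumes p: "p permutes {1..n}"
  shows "card {w \<in> carrier V. f p w = w} dvd card (carrier V)"
proof -
  have f_inv: "f p (inv w) = inv (f p w)" if "w \<in> carrier V" for w
    using group_hom.hom_inv[of V V "f p" w] f_hom[OF p] that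
    by (simp add: group_hom_def group_hom_axioms_def)
  have "subgroup {w \<in> carrier V. f p w = w} V"
  proof (rule subgroupI)
    show "{w \<in> carrier V. f p w = w} \<noteq> {}" using f_one[OF p] by auto
  qed (auto simp: f_mult[OF p] f_inv)
  then show ?thesis using lagrange by (metis dvd_triv_right order_def)
qed

text \<open>The affine action is transitive on \<open>V\<close>, so \<open>act\<close> carries any fibre of an equivariant map bijectively to any other.\<close>

lemma equal_fibres:
  assumes \<phi>_act: "\<And>p v. \<lbrakk>p permutes {1..n}; v \<in> carrier V\<rbrakk> \<Longrightarrow> \<phi> (act p v) = p ` \<phi> v"
  shows "\<exists>k. card (carrier V) = card (\<phi> ` carrier V) * k"
proof -
  have le: "card {v \<in> carrier V. \<phi> v = U} \<le> card {v \<in> carrier V. \<phi> v = p ` U}"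
    if p: "p permutes {1..n}" for p U
  proof (rule card_inj_on_le[where f = "act p"])
    show "inj_on (act p) {v \<in> carrier V. \<phi> v = U}"
      using p by (intro inj_on_inverseI[where g = "act (inv' p)"]) (simp add: act_inv_act(1))
    show "act p ` {v \<in> carrier V. \<phi> v = U} \<subseteq> {v \<in> carrier V. \<phi> v = p ` U}"
      using p by (auto simp: \<phi>_act act_closed)
  qed (use finite_carrier in auto)
  have "card {v \<in> carrier V. \<phi> v = Y} = card {v \<in> carrier V. \<phi> v = \<phi> \<one>}"
    if "Y \<in> \<phi> ` carrier V" for Y
  proof -
    obtain v where v: "v \<in> carrier V" "Y = \<phi> v" using \<open>Y \<in> _\<close> by blast
    obtain p where p: "p permutes {1..n}" "Y = \<phi> (g p)" using g_obtain[OF v(1)] v(2) by metis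
    have Y: "Y = p ` \<phi> \<one>"
      using p \<phi>_act[OF p(1) one_closed] act_g[OF p(1) permutes_id] by (simp add: g_id)
    have "inv' p ` Y = \<phi> \<one>"
      unfolding Y using p(1) by (simp add: image_comp permutes_inv_o)
    then show ?thesis
      using le[OF p(1), of "\<phi> \<one>"] le[OF permutes_inv[OF p(1)], of Y] by (simp flip: Y)
  qed
  then have "card (carrier V) = card (\<phi> ` carrier V) * card {v \<in> carrier V. \<phi> v = \<phi> \<one>}"
    by (rule card_eq_card_image_times_fibre[OF finite_carrier])
  then show ?thesis by blast
qed

text \<open>A set \<open>A\<close> that is invariant under the stabilizer defines an equivariant map \<open>g p \<mapsto> p ` A\<close>.
For a singleton \<open>A\<close> this is an equivariant map from \<open>V\<close> to the points.\<close>

lemma invariant_set_equivariant: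
  assumes A: "\<And>h. \<lbrakk>h permutes {1..n}; g h = \<one>\<rbrakk> \<Longrightarrow> h ` A = A"
  obtains \<phi> where "\<And>p. p permutes {1..n} \<Longrightarrow> \<phi> (g p) = p ` A"
    and "\<And>p v. \<lbrakk>p permutes {1..n}; v \<in> carrier V\<rbrakk> \<Longrightarrow> \<phi> (act p v) = p ` \<phi> v"
proof -
  have eq: "p ` A = q ` A" if "p permutes {1..n}" "q permutes {1..n}" "g p = g q" for p q
  proof -
    have "(inv' p \<circ> q) ` A = A"
      using that g_eq_iff[of p q] by (intro A permutes_compose permutes_inv) auto
    then have "p ` A = p ` (inv' p \<circ> q) ` A" by simp
    also have "\<dots> = (p \<circ> (inv' p \<circ> q)) ` A" by (simp only: image_comp)
    also have "p \<circ> (inv' p \<circ> q) = q" using that(1) by (simp only: permutes_inv_o o_assoc id_comp)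
    finally show ?thesis .
  qed
  define \<phi> where "\<phi> v = (SOME U. \<exists>p. p permutes {1..n} \<and> g p = v \<and> U = p ` A)" for v
  have \<phi>: "\<phi> (g p) = p ` A" if "p permutes {1..n}" for p
    unfolding \<phi>_def by (rule someI2_ex) (use that eq in blast)+
  show thesis
  proof (rule that[OF \<phi>])
    fix p v assume p: "p permutes {1..n}" and v: "v \<in> carrier V"
    obtain q where q: "q permutes {1..n}" "v = g q" using g_obtain[OF v] .
    show "\<phi> (act p v) = p ` \<phi> v"
      using p q \<phi>[OF permutes_compose[OF q(1) p]] by (simp add: act_g \<phi> image_comp)
  qed
qed

text \<open>\<open>V\<close> maps equivariantly onto the set of all subsets of \<open>{1..n}\<close> that have as many elements as \<open>A\<close>.\<close>

lemma binomial_dvd_card: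
  assumes "A \<subseteq> {1..n}" and A: "\<And>h. \<lbrakk>h permutes {1..n}; g h = \<one>\<rbrakk> \<Longrightarrow> h ` A = A"
  shows "(n choose card A) dvd card (carrier V)"
proof -
  obtain \<phi> where \<phi>: "\<And>p. p permutes {1..n} \<Longrightarrow> \<phi> (g p) = p ` A"
    "\<And>p v. \<lbrakk>p permutes {1..n}; v \<in> carrier V\<rbrakk> \<Longrightarrow> \<phi> (act p v) = p ` \<phi> v"
    using invariant_set_equivariant[OF A] by blast
  have "\<phi> ` carrier V = {B. B \<subseteq> {1..n} \<and> card B = card A}"
  proof (intro equalityI subsetI)
    fix B assume "B \<in> \<phi> ` carrier V"
    then obtain v where v: "v \<in> carrier V" "B = \<phi> v" by blast
    obtain p where p: "p permutes {1..n}" "v = g p" using g_obtain[OF v(1)] .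
    then have "B = p ` A" using v(2) \<phi>(1)[OF p(1)] by simp
    then show "B \<in> {B. B \<subseteq> {1..n} \<and> card B = card A}"
      using image_mono[OF assms(1), of p] permutes_image[OF p(1)] card_image[OF permutes_inj_on[OF p(1)]]
      by simp
  next
    fix B assume "B \<in> {B. B \<subseteq> {1..n} \<and> card B = card A}"
    then have B: "B \<subseteq> {1..n}" "card A = card B" by auto
    obtain p where p: "p permutes {1..n}" "p ` A = B"
      using permutes_maps_subset_onto[OF finite_atLeastAtMost assms(1) B] .
    show "B \<in> \<phi> ` carrier V"
      by (rule image_eqI[of _ _ "g p"]) (simp_all only: \<phi>(1)[OF p(1)] g_closed[OF p(1)] p(2))
  qed
  then have "card (\<phi> ` carrier V) = n choose card A"
    using n_subsets[of "{1..n}" "card A"] by simp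
  moreover obtain k where "card (carrier V) = card (\<phi> ` carrier V) * k"
    using equal_fibres[OF \<phi>(2)] by blast
  ultimately show ?thesis by simp
qed

lemma card_carrier_dvd_fact: "card (carrier V) dvd fact n"
proof -
  let ?P = "{p. p permutes {1..n}}"
  have "card {p \<in> ?P. g p = v} = card {p \<in> ?P. g p = \<one>}" if "v \<in> g ` ?P" for v
  proof -
    obtain q where q: "q permutes {1..n}" "v = g q" using \<open>v \<in> g ` ?P\<close> by blast
    have "bij_betw (\<lambda>h. q \<circ> h) {p \<in> ?P. g p = \<one>} {p \<in> ?P. g p = v}"
    proof (rule bij_betw_byWitness[where f' = "\<lambda>p. inv' q \<circ> p"])
      show "(\<lambda>h. q \<circ> h) ` {p \<in> ?P. g p = \<one>} \<subseteq> {p \<in> ?P. g p = v}"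
        using q by (auto simp: permutes_compose g_comp f_one g_closed)
      show "(\<lambda>p. inv' q \<circ> p) ` {p \<in> ?P. g p = v} \<subseteq> {p \<in> ?P. g p = \<one>}"
      proof (rule image_subsetI)
        fix p assume "p \<in> {p \<in> ?P. g p = v}"
        then show "inv' q \<circ> p \<in> {p \<in> ?P. g p = \<one>}"
          using q g_eq_iff[of q p] by (simp add: permutes_compose permutes_inv)
      qed
    qed (use q in \<open>auto simp: o_assoc permutes_inv_o\<close>)
    then show ?thesis by (simp add: bij_betw_same_card)
  qed
  from card_eq_card_image_times_fibre[OF _ this]
  have "card ?P = card (carrier V) * card {p \<in> ?P. g p = \<one>}"
    using finite_permutations[of "{1..n}"] g_surj by simp
  moreover have "card ?P = fact n" using card_permutations[of "{1..n}" n] by simp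
  ultimately show ?thesis by (metis dvd_triv_left)
qed

text \<open>Suppose that the stabilizer fixes \<open>x\<close>. Then \<open>V\<close> maps equivariantly onto the points, and \<open>p\<close> divides \<open>n\<close>. Take
for \<open>t\<close> a transposition if \<open>p\<close> is odd and a 3-cycle if \<open>p = 2\<close>; it has prime order \<open>r \<noteq> p\<close>. The set \<open>F\<close> of its fixed
points on \<open>V\<close> is nonempty because \<open>r\<close> does not divide \<open>|V|\<close>, and \<open>|F|\<close> is a power of \<open>p\<close> because \<open>F\<close> corresponds to a
subgroup of \<open>V\<close>. On the other hand \<open>F\<close> lies over the \<open>n - r\<close> fixed points of \<open>t\<close> in \<open>{1..n}\<close>, and these are
permuted transitively by transpositions that commute with \<open>t\<close>, so \<open>n - r\<close> divides \<open>|F|\<close>. As \<open>n - r > 1\<close>,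
\<open>p\<close> divides \<open>n - r\<close>, hence divides \<open>r\<close>.\<close>

lemma stabilizer_no_fixed_point:
  assumes n: "n \<ge> 5" and p: "prime p" and card: "card (carrier V) = p ^ m"
    and x: "x \<in> {1..n}"
  shows "\<exists>h. h permutes {1..n} \<and> g h = \<one> \<and> h x \<noteq> x"
proof (rule ccontr)
  assume "\<not> ?thesis"
  then have fixed: "h x = x" if "h permutes {1..n}" "g h = \<one>" for h
    using that(1) that(2) by metis
  have inv: "h ` {x} = {x}" if "h permutes {1..n}" "g h = \<one>" for h
    using fixed[OF that] by simp
  have "n choose card {x} dvd card (carrier V)"
    by (rule binomial_dvd_card[OF _ inv]) (use x in auto)
  then have "n dvd p ^ m" using card by simp
  then have p_dvd_n: "p dvd n"
    using n by (intro prime_dvd_of_dvd_prime_power[OF p]) auto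
  define r :: nat where "r = (if p = 2 then 3 else 2)"
  have r: "prime r" "r \<noteq> p" "r < n" "n - r \<ge> 2" using n by (auto simp: r_def)
  define t :: "nat \<Rightarrow> nat" where "t = (if p = 2 then transpose 1 2 \<circ> transpose 2 3 else transpose 1 2)"
  have t: "t permutes {1..n}"
    using n unfolding t_def by (auto intro!: permutes_compose permutes_swap_id)
  have t_id: "t ^^ r = id"
    by (cases "p = 2") (simp_all add: t_def r_def fun_eq_iff transpose_def numeral_3_eq_3 numeral_2_eq_2)
  have t_fix: "y \<in> {1..n} \<and> t y = y \<longleftrightarrow> y \<in> {r + 1..n}" for y
    using n by (cases "p = 2") (auto simp: t_def r_def transpose_def split: if_splits)
  obtain \<phi> where \<phi>: "\<And>q. q permutes {1..n} \<Longrightarrow> \<phi> (g q) = q ` {x}"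
    "\<And>q v. \<lbrakk>q permutes {1..n}; v \<in> carrier V\<rbrakk> \<Longrightarrow> \<phi> (act q v) = q ` \<phi> v"
    using invariant_set_equivariant[OF inv] by blast
  have \<phi>_point: "\<exists>y\<in>{1..n}. \<phi> v = {y}" if v: "v \<in> carrier V" for v
  proof -
    obtain q where q: "q permutes {1..n}" "v = g q" using g_obtain[OF v] .
    then show ?thesis using \<phi>(1) x permutes_in_image[OF q(1)] by simp
  qed
  define F where "F = {v \<in> carrier V. act t v = v}"
  have iter: "(act t ^^ k) v = act (t ^^ k) v \<and> t ^^ k permutes {1..n}" if "v \<in> carrier V" for k v
    using that t by (induction k) (simp_all add: act_id act_comp permutes_compose permutes_id)
  have "[card (carrier V) = card F] (mod r)"
    unfolding F_def
    by (rule card_cong_card_fixed_points[OF r(1) finite_carrier])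
      (simp_all only: act_closed[OF t] iter t_id act_id)
  then have "r dvd card (carrier V) \<longleftrightarrow> r dvd card F" by (rule cong_dvd_iff)
  moreover have "\<not> r dvd card (carrier V)"
  proof
    assume "r dvd card (carrier V)"
    then have "r dvd p" unfolding card by (rule prime_dvd_power[OF r(1)])
    then show False using primes_dvd_imp_eq[OF r(1) p] r(2) by simp
  qed
  ultimately have "F \<noteq> {}" by auto
  then obtain v0 where v0: "v0 \<in> F" by blast
  then have "card F = card {w \<in> carrier V. f t w = w}"
    using card_fixed_points_act[OF t, of v0] unfolding F_def by simp
  then have F_dvd: "card F dvd p ^ m"
    using card_fixed_points_f_dvd[OF t] card by simp
  have \<phi>_F: "\<exists>y\<in>{r + 1..n}. \<phi> v = {y}" if v: "v \<in> F" for v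
  proof -
    have "v \<in> carrier V" using v by (simp add: F_def)
    from \<phi>_point[OF this] obtain y where y: "y \<in> {1..n}" "\<phi> v = {y}" by blast
    have "t y = y" using \<phi>(2)[OF t, of v] v y by (simp add: F_def)
    then have "y \<in> {r + 1..n}" using y(1) t_fix[of y] by blast
    then show ?thesis using y(2) by blast
  qed
  have move: "act (transpose y z) v \<in> F \<and> \<phi> (act (transpose y z) v) = {z}"
    if "v \<in> F" "\<phi> v = {y}" "y \<in> {r + 1..n}" "z \<in> {r + 1..n}" for v y z
  proof -
    have yz: "transpose y z permutes {1..n}" using that by (intro permutes_swap_id) auto
    have "inv' t y = y" "inv' t z = z"
      using t_fix[of y] t_fix[of z] that(3,4) permutes_inv_eq[OF t] by simp_all
    then have "t \<circ> transpose y z = transpose y z \<circ> t"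
      using transpose_comp_eq[OF permutes_bij[OF t], of y z] by simp
    moreover have "v \<in> carrier V" using that(1) by (simp add: F_def)
    ultimately have "act t (act (transpose y z) v) = act (transpose y z) (act t v)"
      using act_comp[OF t yz, of v] act_comp[OF yz t, of v] by simp
    then show ?thesis using that yz \<phi>(2)[OF yz, of v] by (simp add: F_def act_closed)
  qed
  have le: "card {v \<in> F. \<phi> v = {y}} \<le> card {v \<in> F. \<phi> v = {z}}"
    if "y \<in> {r + 1..n}" "z \<in> {r + 1..n}" for y z
  proof (rule card_inj_on_le[where f = "act (transpose y z)"])
    have yz: "transpose y z permutes {1..n}" using that by (intro permutes_swap_id) auto
    show "inj_on (act (transpose y z)) {v \<in> F. \<phi> v = {y}}"
      by (intro inj_on_inverseI[where g = "act (inv' (transpose y z))"])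
        (simp add: F_def act_inv_act(1)[OF yz] del: inv_transpose_eq)
    show "act (transpose y z) ` {v \<in> F. \<phi> v = {y}} \<subseteq> {v \<in> F. \<phi> v = {z}}"
    proof (rule image_subsetI)
      fix v assume "v \<in> {v \<in> F. \<phi> v = {y}}"
      then show "act (transpose y z) v \<in> {v \<in> F. \<phi> v = {z}}"
        using move[OF _ _ that, of v] by simp
    qed
    show "finite {v \<in> F. \<phi> v = {z}}" using finite_carrier by (simp add: F_def)
  qed
  from \<phi>_F[OF v0] obtain y0 where y0: "y0 \<in> {r + 1..n}" "\<phi> v0 = {y0}" by blast
  have image: "\<phi> ` F = (\<lambda>y. {y}) ` {r + 1..n}"
  proof (intro equalityI subsetI)
    fix Y assume "Y \<in> (\<lambda>y. {y}) ` {r + 1..n}"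
    then obtain z where z: "z \<in> {r + 1..n}" "Y = {z}" by blast
    show "Y \<in> \<phi> ` F"
      unfolding z(2) using move[OF v0 y0(2,1) z(1)] by (metis imageI)
  next
    fix Y assume "Y \<in> \<phi> ` F"
    then obtain v where v: "v \<in> F" "Y = \<phi> v" by blast
    then show "Y \<in> (\<lambda>y. {y}) ` {r + 1..n}" using \<phi>_F[OF v(1)] by auto
  qed
  have "card F = card (\<phi> ` F) * card {v \<in> F. \<phi> v = {y0}}"
  proof (rule card_eq_card_image_times_fibre)
    show "finite F" using finite_carrier by (simp add: F_def)
    fix Y assume "Y \<in> \<phi> ` F"
    then obtain z where z: "z \<in> {r + 1..n}" "Y = {z}" unfolding image by blast
    show "card {v \<in> F. \<phi> v = Y} = card {v \<in> F. \<phi> v = {y0}}"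
      unfolding z(2) using le[OF z(1) y0(1)] le[OF y0(1) z(1)] by (rule le_antisym)
  qed
  also have "card (\<phi> ` F) = n - r" unfolding image by (subst card_image) auto
  finally have "n - r dvd card F" by (rule dvdI)
  then have "n - r dvd p ^ m" using F_dvd by (rule dvd_trans)
  then have "p dvd n - r"
    by (rule prime_dvd_of_dvd_prime_power[OF p]) (use r(4) in linarith)
  then have "p dvd r" by (rule dvd_diffD1[OF _ p_dvd_n]) (use r(3) in linarith)
  then have "p = r" by (rule primes_dvd_imp_eq[OF p r(1)])
  then show False using r(2) by simp
qed

lemma stabilizer_comp:
  assumes "h permutes {1..n}" "g h = \<one>" "k permutes {1..n}" "g k = \<one>"
  shows "g (h \<circ> k) = \<one>"
  using assms by (simp add: g_comp f_one)

lemma stabilizer_inv: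
  assumes "h permutes {1..n}" "g h = \<one>"
  shows "g (inv' h) = \<one>"
  using g_eq_iff[OF assms(1) permutes_id] assms(2) by (simp add: g_id)

text \<open>An orbit \<open>A\<close> of the stabilizer other than \<open>{1..n}\<close> would make \<open>n choose card A\<close> a divisor of \<open>p ^ m\<close>, hence a power of \<open>p\<close>. So
\<open>A\<close> or its complement is a single fixed point.\<close>

lemma stabilizer_transitive:
  assumes n: "n \<ge> 5" and p: "prime p" and card: "card (carrier V) = p ^ m"
    and xy: "x \<in> {1..n}" "y \<in> {1..n}"
  obtains h where "h permutes {1..n}" "g h = \<one>" "h x = y"
proof (rule ccontr)
  assume neg: "\<not> thesis"
  define A where "A = {h x |h. h permutes {1..n} \<and> g h = \<one>}"
  have sub: "h ` A \<subseteq> A" if h: "h permutes {1..n}" "g h = \<one>" for h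
  proof (rule image_subsetI)
    fix a assume "a \<in> A"
    then obtain k where k: "k permutes {1..n}" "g k = \<one>" "a = k x" by (auto simp: A_def)
    then have "(h \<circ> k) permutes {1..n}" "g (h \<circ> k) = \<one>"
      using h by (simp_all add: permutes_compose stabilizer_comp)
    then show "h a \<in> A" unfolding A_def k(3) by (intro CollectI exI[of _ "h \<circ> k"]) simp
  qed
  have inv: "h ` A = A" if h: "h permutes {1..n}" "g h = \<one>" for h
  proof (rule equalityI[OF sub[OF h]], rule subsetI)
    fix a assume "a \<in> A"
    then have "inv' h a \<in> A"
      using subsetD[OF sub[OF permutes_inv[OF h(1)] stabilizer_inv[OF h]]] by simp
    then show "a \<in> h ` A"
      by (rule image_eqI[rotated]) (simp add: permutes_inverses(1)[OF h(1)])
  qed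
  have A_sub: "A \<subseteq> {1..n}"
  proof
    fix a assume "a \<in> A"
    then obtain h where "h permutes {1..n}" "a = h x" by (auto simp: A_def)
    then show "a \<in> {1..n}" using permutes_in_image[of h "{1..n}" x] xy(1) by simp
  qed
  have xA: "x \<in> A"
    unfolding A_def by (intro CollectI exI[of _ id]) (simp add: g_id permutes_id)
  have "y \<notin> A"
  proof
    assume "y \<in> A"
    then obtain h where h: "h permutes {1..n}" "g h = \<one>" "h x = y" by (auto simp: A_def)
    show False using that[OF h] neg by contradiction
  qed
  then have "A \<subset> {1..n}" using A_sub xy(2) by blast
  then have "card A < n" using psubset_card_mono[of "{1..n}" A] by simp
  moreover have "card A > 0" using xA A_sub finite_subset[OF A_sub] card_gt_0_iff by blast
  moreover have "(n choose card A) dvd p ^ m" using binomial_dvd_card[OF A_sub inv] card by simp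
  then obtain j where "n choose card A = p ^ j" using divides_primepow_nat[OF p] by blast
  ultimately have "card A = 1 \<or> card A = n - 1"
    using binomial_prime_power_imp[OF p n] by blast
  then show False
  proof
    assume "card A = 1"
    then obtain a where "A = {a}" by (rule card_1_singletonE)
    then have "A = {x}" using xA by simp
    then have "h x = x" if "h permutes {1..n}" "g h = \<one>" for h
      using inv[OF that] by simp
    moreover obtain h where "h permutes {1..n}" "g h = \<one>" "h x \<noteq> x"
      using stabilizer_no_fixed_point[OF n p card xy(1)] by auto
    ultimately show False by simp
  next
    assume "card A = n - 1"
    then have "card ({1..n} - A) = 1"
      using n A_sub finite_subset[OF A_sub] by (simp add: card_Diff_subset)
    then obtain z where z: "{1..n} - A = {z}" by (rule card_1_singletonE)
    have "h z = z" if h: "h permutes {1..n}" "g h = \<one>" for h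
    proof -
      have "h ` ({1..n} - A) = {1..n} - A"
        using permutes_image[OF h(1)] inv[OF h] permutes_inj[OF h(1)] by (simp add: image_set_diff)
      then show ?thesis unfolding z by simp
    qed
    moreover have "z \<in> {1..n}" using z by blast
    then obtain h where "h permutes {1..n}" "g h = \<one>" "h z \<noteq> z"
      using stabilizer_no_fixed_point[OF n p card, of z] by auto
    ultimately show False by simp
  qed
qed

text \<open>Since \<open>g (q \<circ> h) = g q\<close> for \<open>h\<close> in the stabilizer, and the stabilizer is transitive, every value of
\<open>g\<close> is attained at a permutation that fixes \<open>n\<close>.\<close>

lemma restrict_cocycle:
  assumes n: "n \<ge> 5" and p: "prime p" and card: "card (carrier V) = p ^ m"
  shows "sym_cocycle V (n - 1) f g"
proof
  have perm: "q permutes {1..n}" if "q permutes {1..n - 1}" for q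
    using permutes_subset[OF that] by auto
  show "f q \<in> hom V V" if "q permutes {1..n - 1}" for q using f_hom[OF perm[OF that]] .
  show "g (q \<circ> r) = g q \<otimes> f q (g r)" if "q permutes {1..n - 1}" "r permutes {1..n - 1}" for q r
    using g_comp[OF perm[OF that(1)] perm[OF that(2)]] .
  show "g ` {q. q permutes {1..n - 1}} = carrier V"
  proof (intro equalityI subsetI)
    fix v assume "v \<in> carrier V"
    then obtain q where q: "q permutes {1..n}" "v = g q" by (rule g_obtain)
    have "n \<in> {1..n}" using n by simp
    moreover have "inv' q n \<in> {1..n}"
      using n permutes_in_image[OF permutes_inv[OF q(1)], of n] by simp
    ultimately obtain h where h: "h permutes {1..n}" "g h = \<one>" "h n = inv' q n"
      using stabilizer_transitive[OF n p card, of n "inv' q n"] by metis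
    have "(q \<circ> h) n = n" using h(3) permutes_inverses(1)[OF q(1)] by simp
    moreover have "x = n" if "x \<in> {1..n} - {1..n - 1}" for x using that by auto
    ultimately have "(q \<circ> h) permutes {1..n - 1}"
      using permutes_superset[OF permutes_compose[OF h(1) q(1)], of "{1..n - 1}"] by metis
    moreover have "v = g (q \<circ> h)"
      using q h g_closed[OF q(1)] by (simp add: g_comp f_one)
    ultimately show "v \<in> g ` {q. q permutes {1..n - 1}}" by (intro image_eqI) auto
  qed (use g_closed perm in auto)
qed

definition linear_kernel :: "(nat \<Rightarrow> nat) set"
  where "linear_kernel = {p. p permutes {1..n} \<and> (\<forall>v\<in>carrier V. f p v = v)}"

lemma linear_kernel_normal: "linear_kernel \<lhd> sym_group n"
proof (rule group.normal_invI[OF sym_group_is_group])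
  have inv: "inv' p \<in> linear_kernel" if "p \<in> linear_kernel" for p
    using that f_inv_f(1)[of p] by (auto simp: linear_kernel_def permutes_inv)
  show "subgroup linear_kernel (sym_group n)"
  proof (rule group.subgroupI[OF sym_group_is_group])
    show "linear_kernel \<subseteq> carrier (sym_group n)"
      by (auto simp: linear_kernel_def sym_group_carrier)
    show "linear_kernel \<noteq> {}"
      unfolding linear_kernel_def using f_id permutes_id[of "{1..n}"] by (auto intro!: exI[of _ id])
    show "inv\<^bsub>sym_group n\<^esub> p \<in> linear_kernel" if "p \<in> linear_kernel" for p
      using that inv by (simp add: linear_kernel_def sym_group_carrier)
    show "p \<otimes>\<^bsub>sym_group n\<^esub> q \<in> linear_kernel" if "p \<in> linear_kernel" "q \<in> linear_kernel" for p q
      using that by (auto simp: linear_kernel_def sym_group_mult permutes_compose f_comp)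
  qed
  show "q \<otimes>\<^bsub>sym_group n\<^esub> p \<otimes>\<^bsub>sym_group n\<^esub> inv\<^bsub>sym_group n\<^esub> q \<in> linear_kernel"
    if "p \<in> linear_kernel" "q \<in> carrier (sym_group n)" for p q
  proof -
    have pq: "p permutes {1..n}" "q permutes {1..n}"
      using that by (auto simp: linear_kernel_def sym_group_carrier)
    have "f (q \<circ> p \<circ> inv' q) v = v" if "v \<in> carrier V" for v
      using that pq \<open>p \<in> linear_kernel\<close> f_inv_f(2)[OF pq(2)]
      by (simp add: f_comp permutes_compose permutes_inv f_closed linear_kernel_def)
    then show ?thesis
      using pq that(2) by (simp add: linear_kernel_def sym_group_mult permutes_compose permutes_inv)
  qed
qed

lemma alt_group_subset_linear_kernel:
  assumes "n \<ge> 5" "p permutes {1..n}" "p \<noteq> id" "\<And>v. v \<in> carrier V \<Longrightarrow> f p v = v"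
  shows "carrier (alt_group n) \<subseteq> linear_kernel"
  using assms by (intro normal_subgroup_contains_alt_group linear_kernel_normal)
    (auto simp: linear_kernel_def)

text \<open>A prime power dividing 24 is at most 4, or it is 8. The fixed points of a 5-cycle form a subgroup of \<open>V\<close> whose order is congruent
to \<open>|V|\<close> modulo 5; in each of these cases it is all of \<open>V\<close>.\<close>

lemma alt_group_acts_trivially_if_card_dvd_24:
  assumes n: "n \<ge> 5" and p: "prime p" and card: "card (carrier V) = p ^ m"
    and dvd: "card (carrier V) dvd 24"
  shows "carrier (alt_group n) \<subseteq> linear_kernel"
proof -
  define c :: "nat \<Rightarrow> nat" where
    "c x = (if x = 0 \<or> x > 5 then x else if x = 5 then 1 else Suc x)" for x
  have "bij_betw c {1..5} {1..5}"
    by (rule bij_betw_byWitness[where f' = "\<lambda>x. if x = 1 then 5 else x - 1"]) (auto simp: c_def)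
  then have "c permutes {1..5}" by (rule bij_imp_permutes) (auto simp: c_def)
  then have c: "c permutes {1..n}" by (rule permutes_subset) (use n in auto)
  have "c 1 \<noteq> 1" by (simp add: c_def)
  then have "c \<noteq> id" by auto
  have c5: "c ^^ 5 = id"
  proof
    fix x
    have "(c ^^ 5) x = c (c (c (c (c x))))" by (simp add: eval_nat_numeral)
    moreover have "x = 0 \<or> x > 5 \<or> x = 1 \<or> x = 2 \<or> x = 3 \<or> x = 4 \<or> x = 5" by linarith
    ultimately show "(c ^^ 5) x = id x" by (elim disjE) (simp_all add: c_def)
  qed
  define F where "F = {v \<in> carrier V. f c v = v}"
  have iter: "(f c ^^ k) v = f (c ^^ k) v \<and> c ^^ k permutes {1..n}" if "v \<in> carrier V" for k v
    using that c by (induction k) (simp_all add: f_id f_comp permutes_compose permutes_id)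
  have "[card (carrier V) = card F] (mod 5)"
    unfolding F_def
    by (rule card_cong_card_fixed_points[OF _ finite_carrier])
      (simp_all only: f_closed[OF c] iter c5 f_id, simp)
  moreover have "card F dvd card (carrier V)" unfolding F_def by (rule card_fixed_points_f_dvd[OF c])
  moreover have "card (carrier V) \<in> {1, 2, 3, 4, 8}"
  proof -
    \<comment> \<open>A divisor of 24 outside of this set is a multiple of 6, which a prime power cannot be.\<close>
    have "card (carrier V) \<le> 24" using dvd by (intro dvd_imp_le) auto
    moreover have "list_all (\<lambda>d::nat. d dvd 24 \<longrightarrow> d \<in> {1, 2, 3, 4, 8} \<or> 6 dvd d) [0..<25]"
      by code_simp
    ultimately have "card (carrier V) \<in> {1, 2, 3, 4, 8} \<or> 6 dvd card (carrier V)"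
      using dvd unfolding list_all_iff by auto
    moreover have "\<not> 6 dvd card (carrier V)"
    proof
      assume "6 dvd card (carrier V)"
      then have "6 dvd p ^ m" by (simp add: card)
      then have "2 dvd p ^ m" "3 dvd p ^ m"
        by (rule dvd_trans[rotated], simp)+
      then have "2 dvd p" "3 dvd p"
        by (auto intro: prime_dvd_power simp del: even_power)
      then have "2 = p" "3 = p"
        using primes_dvd_imp_eq[OF two_is_prime_nat p] primes_dvd_imp_eq[OF _ p, of 3] by simp_all
      then show False by simp
    qed
    ultimately show ?thesis by blast
  qed
  ultimately have cases: "card (carrier V) \<in> {1, 2, 3, 4, 8}" "card F dvd card (carrier V)"
    "card (carrier V) mod 5 = card F mod 5"
    by (simp_all add: cong_def)
  then have le: "card F \<le> card (carrier V)" by (auto intro: dvd_imp_le)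
  have "card F = card (carrier V)"
  proof (cases "card (carrier V) = 8")
    case True
    then have "card F mod 5 = 3" "card F \<le> 8" using cases(3) le by simp_all
    then have "card F = 3 \<or> card F = 8" by presburger
    then show ?thesis using cases(2) True by auto
  next
    case False
    then show ?thesis using cases(1,3) le by auto
  qed
  then have "F = carrier V"
    using card_subset_eq[OF finite_carrier] by (simp add: F_def)
  then show ?thesis
    using n c \<open>c \<noteq> id\<close> by (intro alt_group_subset_linear_kernel[of c]) (auto simp: F_def)
qed

text \<open>On \<open>A\<^sub>n\<close> the map \<open>g\<close> is a homomorphism to an abelian group, and \<open>A\<^sub>n\<close> is perfect, so \<open>g\<close> is trivial there. It is then constant
on the coset of odd permutations.\<close>

lemma abelian_card_le_2_if_alt_group_acts_trivially:
  assumes n: "n \<ge> 5" and comm: "comm_group V" and ker: "carrier (alt_group n) \<subseteq> linear_kernel"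
  shows "card (carrier V) \<le> 2"
proof -
  have "g \<in> hom (alt_group n) V"
  proof (rule homI)
    fix p q assume pq: "p \<in> carrier (alt_group n)" "q \<in> carrier (alt_group n)"
    then have "p \<in> linear_kernel" "p permutes {1..n}" "q permutes {1..n}"
      using ker by (auto simp: alt_group_carrier)
    then show "g (p \<otimes>\<^bsub>alt_group n\<^esub> q) = g p \<otimes> g q"
      by (simp add: alt_group_mult g_comp linear_kernel_def g_closed)
  qed (simp add: alt_group_carrier g_closed)
  then interpret A: group_hom "alt_group n" V g
    by (intro group_hom.intro group_hom_axioms.intro alt_group_is_group is_group)
  have "g ` carrier (alt_group n) = derived V (g ` carrier (alt_group n))"
    using A.derived_img[OF subset_refl] by (simp only: derived_alt_group_const[OF n])
  also have "\<dots> = {\<one>}"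
    by (rule comm_group.derived_eq_singleton[OF comm]) (auto simp: alt_group_carrier g_closed)
  finally have "g ` carrier (alt_group n) = {\<one>}" .
  then have g_even: "g p = \<one>" if "p permutes {1..n}" "evenperm p" for p
  proof -
    have "g p \<in> g ` carrier (alt_group n)" using that by (simp add: alt_group_carrier)
    then show ?thesis by (simp add: \<open>g ` carrier (alt_group n) = {\<one>}\<close>)
  qed
  define s :: "nat \<Rightarrow> nat" where "s = transpose 1 2"
  have s: "s permutes {1..n}" "\<not> evenperm s"
    using n by (simp_all add: s_def permutes_swap_id evenperm_swap)
  have "g p \<in> {\<one>, g s}" if p: "p permutes {1..n}" for p
  proof (cases "evenperm p")
    case False
    have "evenperm (s \<circ> p)"
      using evenperm_comp[of s p] s(2) False permutes_imp_permutation[OF _ s(1)]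
        permutes_imp_permutation[OF _ p] by simp
    then have sp: "g (s \<circ> p) = \<one>" using g_even permutes_compose[OF p s(1)] by simp
    have "g p = g (s \<circ> (s \<circ> p))" by (simp add: s_def o_assoc)
    also have "\<dots> = g s \<otimes> f s (g (s \<circ> p))"
      by (rule g_comp[OF s(1) permutes_compose[OF p s(1)]])
    also have "\<dots> = g s" unfolding sp using s(1) by (simp add: f_one g_closed)
    finally show ?thesis by simp
  qed (use g_even p in simp)
  then have "g ` {p. p permutes {1..n}} \<subseteq> {\<one>, g s}" by (intro image_subsetI) simp
  then have "carrier V \<subseteq> {\<one>, g s}" by (simp only: g_surj)
  then have "card (carrier V) \<le> card {\<one>, g s}" by (intro card_mono) auto
  also have "\<dots> \<le> 2" by (simp add: card_insert_if)
  finally show ?thesis .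
qed

end

lemma card_prime_power_cocycle_dvd_24:
  assumes "n \<ge> 4" "sym_cocycle V n f g" "prime p" "card (carrier V) = p ^ m"
  shows "card (carrier V) dvd 24"
  using assms
proof (induction n rule: nat_induct_at_least)
  case base
  then interpret sym_cocycle V 4 f g by simp
  show ?case using card_carrier_dvd_fact by (simp add: fact_numeral)
next
  case (Suc n)
  then interpret sym_cocycle V "Suc n" f g by simp
  show ?case
    using Suc restrict_cocycle[of p m] by simp
qed

text \<open>By Sylow's theorem there is an element of order \<open>q\<close>.\<close>

lemma (in group) prime_dvd_exponent:
  assumes fin: "finite (carrier G)" and exp: "\<And>x. x \<in> carrier G \<Longrightarrow> x [^] (e::nat) = \<one>"
    and q: "prime q" "q dvd order G"
  shows "q dvd e"
proof -
  obtain m where m: "order G = q ^ 1 * m" using q(2) by (auto elim: dvdE)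
  obtain H where H: "subgroup H G" "card H = q ^ 1"
    using sylow_thm[OF q(1) is_group m fin] by blast
  interpret H: group "G\<lparr>carrier := H\<rparr>" using subgroup_imp_group[OF H(1)] .
  have "H \<noteq> {\<one>}" using H(2) q(1) by auto
  then obtain x where x: "x \<in> H" "x \<noteq> \<one>" using subgroup.one_closed[OF H(1)] by blast
  have xG: "x \<in> carrier G" using x(1) H(1) subgroup.mem_carrier by metis
  have "x [^]\<^bsub>G\<lparr>carrier := H\<rparr>\<^esub> q = \<one>"
    using H.pow_order_eq_1[of x] x(1) H(2) by (simp add: order_def)
  then have "x [^] q = \<one>" by (simp add: nat_pow_consistent[symmetric])
  then have "ord x dvd q" using pow_eq_id[OF xG] by blast
  moreover have "ord x \<noteq> 1" using x(2) ord_eq_1[OF xG] by blast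
  ultimately have "ord x = q" using q(1) prime_nat_iff by blast
  then show ?thesis using pow_eq_id[OF xG, of e] exp[OF xG] by simp
qed

text \<open>Suppose that an odd prime \<open>p\<close> divides \<open>|V| = p ^ a * k\<close>, where \<open>p\<close> does not divide \<open>k\<close>. The image \<open>W\<close> of the \<open>k\<close>-th power map is a
\<open>p\<close>-group, onto which \<open>g\<close> followed by this map is again a crossed homomorphism. The prime power case gives \<open>|W| \<le> 2\<close>, so \<open>W\<close> is
trivial; then \<open>V\<close> has exponent dividing \<open>k\<close>, contrary to \<open>p\<close> dividing \<open>|V|\<close>. So \<open>V\<close> is a 2-group, and the prime power case
applies to \<open>V\<close> itself.\<close>

theorem abelian_cocycle_card_le_2:
  fixes V :: "('a, 'b) monoid_scheme" (structure)
  assumes n: "n \<ge> 5" and V: "sym_cocycle V n f g" and comm: "comm_group V"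
  shows "card (carrier V) \<le> 2"
proof -
  have prime_power: "card (carrier W) \<le> 2"
    if W: "sym_cocycle W n f g'" "comm_group W" and p: "prime p" "card (carrier W) = p ^ m"
    for W :: "('a, 'b) monoid_scheme" and g' and p m :: nat
  proof -
    interpret sym_cocycle W n f g' by fact
    show ?thesis
      using n W p card_prime_power_cocycle_dvd_24[of n W f g' p m]
      by (intro abelian_card_le_2_if_alt_group_acts_trivially alt_group_acts_trivially_if_card_dvd_24[of p m]) auto
  qed
  interpret sym_cocycle V n f g by fact
  interpret V: comm_group V by fact
  have pos: "card (carrier V) > 0" using finite_carrier card_gt_0_iff by blast
  have "p = 2" if p: "prime p" "p dvd card (carrier V)" for p
  proof (rule ccontr)
    assume "p \<noteq> 2"
    have nz: "card (carrier V) \<noteq> 0" "\<not> is_unit p" using pos p(1) by auto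
    obtain a k where k: "card (carrier V) = p ^ a * k" "\<not> p dvd k"
      using multiplicity_decompose'[OF nz] by metis
    define W where "W = V\<lparr>carrier := (\<lambda>v. v [^] k) ` carrier V\<rparr>"
    interpret pow: group_hom V V "\<lambda>v. v [^] k"
      by unfold_locales (auto intro!: homI simp: V.nat_pow_distrib)
    have sub: "subgroup (carrier W) V" using pow.img_is_subgroup by (simp add: W_def)
    then have W_group: "group W" using subgroup_imp_group by (simp add: W_def)
    have W_comm: "comm_group W"
    proof (rule group.group_comm_groupI[OF W_group])
      fix x y assume "x \<in> carrier W" "y \<in> carrier W"
      then show "x \<otimes>\<^bsub>W\<^esub> y = y \<otimes>\<^bsub>W\<^esub> x"
        using V.m_comm[of x y] subgroup.mem_carrier[OF sub] by (simp add: W_def)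
    qed
    have "sym_cocycle W n f (\<lambda>q. g q [^] k)"
    proof (intro sym_cocycle.intro[OF W_group] sym_cocycle_axioms.intro)
      \<comment> \<open>As \<open>f q\<close> commutes with powers, the same \<open>f\<close> serves for \<open>W\<close>.\<close>
      have f_pow: "f q (v [^] k) = f q v [^] k" if "q permutes {1..n}" "v \<in> carrier V" for q v
        using hom_nat_pow[OF f_hom[OF that(1)] that(2) is_group is_group] .
      fix q assume q: "q permutes {1..n}"
      show "f q \<in> hom W W"
      proof (rule homI)
        fix x assume "x \<in> carrier W"
        then obtain v where v: "v \<in> carrier V" "x = v [^] k" by (auto simp: W_def)
        then have "f q x = f q v [^] k" using f_pow[OF q v(1)] by simp
        then show "f q x \<in> carrier W" using f_closed[OF q v(1)] by (simp add: W_def)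
      next
        fix x y assume "x \<in> carrier W" "y \<in> carrier W"
        then show "f q (x \<otimes>\<^bsub>W\<^esub> y) = f q x \<otimes>\<^bsub>W\<^esub> f q y"
          using f_mult[OF q] subgroup.mem_carrier[OF sub] by (simp add: W_def)
      qed
      fix r assume "r permutes {1..n}"
      then show "g (q \<circ> r) [^] k = g q [^] k \<otimes>\<^bsub>W\<^esub> f q (g r [^] k)"
        using q by (simp add: W_def g_comp V.nat_pow_distrib f_pow g_closed f_closed)
    next
      show "(\<lambda>q. g q [^] k) ` {q. q permutes {1..n}} = carrier W"
        unfolding W_def g_surj[symmetric] by (simp add: image_image)
    qed
    moreover obtain m where m: "card (carrier W) = p ^ m"
    proof -
      have W_exp: "x [^]\<^bsub>W\<^esub> p ^ a = \<one>\<^bsub>W\<^esub>" if x: "x \<in> carrier W" for x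
      proof -
        obtain v where v: "v \<in> carrier V" "x = v [^] k" using x by (auto simp: W_def)
        then have "x [^] p ^ a = v [^] card (carrier V)"
          using k(1) by (simp add: nat_pow_pow mult.commute)
        then show ?thesis
          using pow_order_eq_1[OF v(1)] by (simp add: W_def nat_pow_consistent[symmetric] order_def)
      qed
      have "coprime (card (carrier W)) k"
      proof (rule ccontr)
        assume "\<not> ?thesis"
        then obtain d where d: "d dvd card (carrier W)" "d dvd k" "\<not> is_unit d"
          by (rule not_coprimeE)
        then obtain q where "prime q" "q dvd d" using prime_factor_nat[of d] by auto
        then have q: "prime q" "q dvd card (carrier W)" "q dvd k"
          using d(1,2) by (auto intro: dvd_trans)
        have "finite (carrier W)" using finite_carrier by (simp add: W_def)
        then have "q dvd p ^ a"
          using group.prime_dvd_exponent[OF W_group _ W_exp q(1)] q(2) by (simp add: order_def)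
        then have "q dvd p" by (rule prime_dvd_power[OF q(1)])
        then have "q = p" by (rule primes_dvd_imp_eq[OF q(1) p(1)])
        then show False using q(3) k(2) by simp
      qed
      moreover have "card (carrier W) dvd p ^ a * k"
        using lagrange[OF sub] k(1) by (metis dvd_triv_right order_def)
      ultimately have "card (carrier W) dvd p ^ a" by (simp add: coprime_dvd_mult_left_iff)
      then obtain m where "card (carrier W) = p ^ m" using divides_primepow_nat[OF p(1)] by auto
      then show thesis by (rule that)
    qed
    ultimately have "p ^ m \<le> 2" using prime_power[OF _ W_comm p(1) m] by simp
    moreover have "p > 2" using \<open>p \<noteq> 2\<close> prime_ge_2_nat[OF p(1)] by simp
    ultimately have "m = 0"
      using self_le_power[of p m] by (cases "m = 0") auto
    then have "card (carrier W) = 1" using m by simp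
    then obtain w where "carrier W = {w}" by (rule card_1_singletonE)
    moreover have "\<one> \<in> carrier W" using subgroup.one_closed[OF sub] .
    ultimately have "carrier W = {\<one>}" by simp
    then have "v [^] k = \<one>" if "v \<in> carrier V" for v
      using that by (auto simp: W_def)
    then have "p dvd k" using prime_dvd_exponent[OF finite_carrier _ p(1)] p(2) by (simp add: order_def)
    then show False using k(2) by simp
  qed
  note two = this
  have nz: "card (carrier V) \<noteq> 0" "\<not> is_unit (2 :: nat)" using pos by auto
  obtain a k where k: "card (carrier V) = 2 ^ a * k" "\<not> 2 dvd k"
    using multiplicity_decompose'[OF nz] by metis
  have "k = 1"
  proof (rule ccontr)
    assume "k \<noteq> 1"
    then obtain q where "prime q" "q dvd k" using prime_factor_nat by blast
    then show False using two[of q] k by auto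
  qed
  then have "card (carrier V) = 2 ^ a" using k(1) by simp
  then show ?thesis by (rule prime_power[OF V comm two_is_prime_nat])
qed

section \<open>Outer automorphisms and the three cases\<close>

text \<open>An image of index 2 is the kernel of the map that sends its elements to 1 and all others to -1.\<close>

lemma (in group) index_two_fits_short_exact:
  assumes fin: "finite (carrier G)" and f: "f \<in> mon A G" and A: "group A"
    and card: "order G = 2 * card (carrier A)"
  shows "fits_short_exact A G sign_img"
proof -
  define I where "I = f ` carrier A"
  have f_hom: "f \<in> hom A G" and f_inj: "inj_on f (carrier A)" using f by (auto simp: mon_def)
  interpret f: group_hom A G f by (intro group_hom.intro group_hom_axioms.intro A is_group f_hom)
  have I: "subgroup I G" unfolding I_def by (rule f.img_is_subgroup)
  have cardI: "order G = 2 * card I" using card f_inj by (simp add: I_def card_image)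
  have I_sub: "I \<subseteq> carrier G" using I subgroup.subset by blast
  have finI: "finite I" using finite_subset[OF I_sub fin] .
  have cardI0: "card I > 0" using finI subgroup.one_closed[OF I] card_gt_0_iff by blast
  have inv_I: "inv x \<in> I" if "x \<in> I" for x using subgroup.m_inv_closed[OF I that] .
  have mult_I: "x \<otimes> y \<in> I" if "x \<in> I" "y \<in> I" for x y using subgroup.m_closed[OF I that] .
  have mult_right: "y \<in> I" if "x \<otimes> y \<in> I" "x \<in> I" "y \<in> carrier G" for x y
  proof -
    have "inv x \<otimes> (x \<otimes> y) \<in> I" using that by (simp add: mult_I inv_I)
    moreover have "x \<in> carrier G" using that I_sub by blast
    ultimately show ?thesis using that(3) by (simp add: m_assoc[symmetric])
  qed
  have mult_left: "x \<in> I" if "x \<otimes> y \<in> I" "y \<in> I" "x \<in> carrier G" for x y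
  proof -
    have "x \<otimes> y \<otimes> inv y \<in> I" using that by (simp add: mult_I inv_I)
    moreover have "y \<in> carrier G" using that I_sub by blast
    ultimately show ?thesis using that(3) by (simp add: m_assoc)
  qed
  \<comment> \<open>Left translation by an element outside \<open>I\<close> swaps \<open>I\<close> and its complement.\<close>
  have outside: "x \<otimes> y \<in> I" if x: "x \<in> carrier G" "x \<notin> I" and y: "y \<in> carrier G" "y \<notin> I" for x y
  proof (rule ccontr)
    assume xy: "x \<otimes> y \<notin> I"
    have "(\<lambda>z. x \<otimes> z) ` I = carrier G - I"
    proof (rule card_subset_eq)
      show "finite (carrier G - I)" using fin by simp
      show "(\<lambda>z. x \<otimes> z) ` I \<subseteq> carrier G - I"
      proof (rule image_subsetI)
        fix z assume z: "z \<in> I"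
        then have "z \<in> carrier G" using I_sub by blast
        moreover have "x \<otimes> z \<notin> I" using mult_left[OF _ z x(1)] x(2) by blast
        ultimately show "x \<otimes> z \<in> carrier G - I" using x(1) by simp
      qed
      have "inj_on (\<lambda>z. x \<otimes> z) I"
        using inj_on_subset[OF inj_on_cmult[OF x(1)] I_sub] .
      then show "card ((\<lambda>z. x \<otimes> z) ` I) = card (carrier G - I)"
        using cardI finI I_sub by (simp add: card_image card_Diff_subset order_def)
    qed
    moreover have "x \<otimes> y \<in> carrier G - I" using x y xy by simp
    ultimately have "x \<otimes> y \<in> (\<lambda>z. x \<otimes> z) ` I" by simp
    then obtain z where z: "z \<in> I" "x \<otimes> y = x \<otimes> z" by auto
    then have "y = z" using l_cancel[of x y z] x y subsetD[OF I_sub] by simp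
    then show False using z y by simp
  qed
  define h where "h x = (if x \<in> I then 1 else - 1 :: int)" for x
  have "h \<in> hom G sign_img"
  proof (rule homI)
    fix x y assume "x \<in> carrier G" "y \<in> carrier G"
    then have "x \<otimes> y \<in> I \<longleftrightarrow> (x \<in> I \<longleftrightarrow> y \<in> I)"
      using mult_I[of x y] mult_left[of x y] mult_right[of x y] outside[of x y] by argo
    then show "h (x \<otimes> y) = h x \<otimes>\<^bsub>sign_img\<^esub> h y"
      by (simp add: h_def sign_img_def)
  qed (simp add: h_def sign_img_def)
  moreover have "h ` carrier G = carrier sign_img"
  proof -
    have "I \<noteq> carrier G" using cardI cardI0 by (auto simp: order_def)
    then obtain x where x: "x \<in> carrier G" "x \<notin> I" using I_sub by blast
    have "h x = - 1" "h \<one> = 1" using x(2) subgroup.one_closed[OF I] by (simp_all add: h_def)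
    then have "- 1 \<in> h ` carrier G" "1 \<in> h ` carrier G"
      using x(1) one_closed image_eqI[of _ h] by metis+
    then show ?thesis by (auto simp: h_def sign_img_def)
  qed
  moreover have "f ` carrier A = kernel G sign_img h"
    using I_sub by (auto simp: kernel_def h_def sign_img_def I_def)
  ultimately show ?thesis
    unfolding fits_short_exact_def epi_def using f by (intro exI[of _ f] exI[of _ h]) simp
qed

lemma order_two_iso_sign_img:
  assumes "group G" and "order G = 2"
  shows "G \<cong> sign_img" and "\<exists>f. f \<in> iso sign_img G"
proof -
  interpret group G by fact
  have "card (carrier G) = 2" using assms(2) by (simp add: order_def)
  then obtain a b where "carrier G = {a, b}" "a \<noteq> b" by (auto simp: card_2_iff)
  then obtain z where z: "carrier G = {\<one>\<^bsub>G\<^esub>, z}" "z \<noteq> \<one>\<^bsub>G\<^esub>" using one_closed by fastforce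
  have zz: "z \<otimes>\<^bsub>G\<^esub> z = \<one>\<^bsub>G\<^esub>"
  proof -
    have "z \<otimes>\<^bsub>G\<^esub> z \<in> {\<one>\<^bsub>G\<^esub>, z}" "z \<in> carrier G" using z m_closed[of z z] by auto
    then show ?thesis using z(2) by auto
  qed
  define f where "f i = (if i = (1::int) then \<one>\<^bsub>G\<^esub> else z)" for i
  have "f \<in> hom sign_img G"
    using z zz by (intro homI) (auto simp: f_def sign_img_def)
  moreover have "bij_betw f (carrier sign_img) (carrier G)"
    using z by (auto simp: bij_betw_def f_def sign_img_def inj_on_def)
  ultimately have f: "f \<in> iso sign_img G" by (simp add: iso_def)
  then show "\<exists>f. f \<in> iso sign_img G" by blast
  show "G \<cong> sign_img"
    using group.iso_set_sym[OF sign_img_is_group f] unfolding is_iso_def by blast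
qed

abbreviation inner :: "('a, 'b) monoid_scheme \<Rightarrow> 'a \<Rightarrow> 'a \<Rightarrow> 'a"
  where "inner G x \<equiv> (\<lambda>y \<in> carrier G. x \<otimes>\<^bsub>G\<^esub> y \<otimes>\<^bsub>G\<^esub> inv\<^bsub>G\<^esub> x)"

context group
begin

lemma auto_mult:
  "\<lbrakk>\<phi> \<in> auto G; \<psi> \<in> auto G\<rbrakk> \<Longrightarrow> \<phi> \<otimes>\<^bsub>AutoGroup G\<^esub> \<psi> = compose (carrier G) \<phi> \<psi>"
  by (simp add: AutoGroup_def BijGroup_def auto_def)

lemma inner_in_auto:
  assumes x: "x \<in> carrier G"
  shows "inner G x \<in> auto G"
proof -
  have cancel: "inv x \<otimes> (x \<otimes> y) = y" "x \<otimes> (inv x \<otimes> y) = y" if "y \<in> carrier G" for y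
    using x that by (simp_all add: m_assoc[symmetric])
  have "inner G x \<in> hom G G"
    using x by (intro homI) (simp_all add: m_assoc cancel)
  moreover have "inner G x \<in> Bij (carrier G)"
  proof -
    have "bij_betw (inner G x) (carrier G) (carrier G)"
      using x by (intro bij_betw_byWitness[where f' = "inner G (inv x)"]) (auto simp: m_assoc cancel)
    then show ?thesis by (simp add: Bij_def)
  qed
  ultimately show ?thesis by (simp add: auto_def)
qed

lemma inner_hom: "inner G \<in> hom G (AutoGroup G)"
proof (rule homI)
  show "inner G x \<in> carrier (AutoGroup G)" if "x \<in> carrier G" for x
    using inner_in_auto[OF that] by (simp add: AutoGroup_def)
  show "inner G (x \<otimes> y) = inner G x \<otimes>\<^bsub>AutoGroup G\<^esub> inner G y"
    if "x \<in> carrier G" "y \<in> carrier G" for x y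
    unfolding auto_mult[OF inner_in_auto inner_in_auto, OF that]
    using that by (auto simp: compose_def fun_eq_iff restrict_def m_assoc inv_mult_group)
qed

lemma inner_auto_normal: "inner_auto G \<lhd> AutoGroup G"
proof -
  interpret Aut: group "AutoGroup G" by (rule AutoGroup)
  interpret inner: group_hom G "AutoGroup G" "inner G"
    by (intro group_hom.intro group_hom_axioms.intro is_group AutoGroup inner_hom)
  show ?thesis
  proof (rule Aut.normal_invI)
    show "subgroup (inner_auto G) (AutoGroup G)"
      unfolding inner_auto_def by (rule inner.img_is_subgroup)
    fix \<psi> \<phi> assume "\<psi> \<in> inner_auto G" and \<phi>: "\<phi> \<in> carrier (AutoGroup G)"
    then obtain x where x: "x \<in> carrier G" "\<psi> = inner G x" by (auto simp: inner_auto_def)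
    have \<phi>_auto: "\<phi> \<in> auto G" using \<phi> by (simp add: AutoGroup_def)
    then have \<phi>_hom: "\<phi> \<in> hom G G" by (simp add: auto_def)
    interpret \<phi>: group_hom G G \<phi>
      by (intro group_hom.intro group_hom_axioms.intro is_group \<phi>_hom)
    have "\<phi> \<otimes>\<^bsub>AutoGroup G\<^esub> \<psi> = inner G (\<phi> x) \<otimes>\<^bsub>AutoGroup G\<^esub> \<phi>"
      unfolding x(2) using x(1) \<phi>_auto inner_in_auto
      by (subst (1 2) auto_mult) (auto simp: compose_def fun_eq_iff restrict_def)
    then have "\<phi> \<otimes>\<^bsub>AutoGroup G\<^esub> \<psi> \<otimes>\<^bsub>AutoGroup G\<^esub> inv\<^bsub>AutoGroup G\<^esub> \<phi> = inner G (\<phi> x)"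
      using \<phi> x inner.hom_closed[OF \<phi>.hom_closed[OF x(1)]] by (simp add: Aut.m_assoc)
    then show "\<phi> \<otimes>\<^bsub>AutoGroup G\<^esub> \<psi> \<otimes>\<^bsub>AutoGroup G\<^esub> inv\<^bsub>AutoGroup G\<^esub> \<phi> \<in> inner_auto G"
      using x(1) by (auto simp: inner_auto_def)
  qed
qed

end

text \<open>A homomorphism whose image lies in that of an injective homomorphism factors through the latter.
It is used in both directions between \<open>A\<^sub>n\<close> and the inner automorphisms.\<close>

lemma hom_factor_through_mon:
  assumes "group G" "group B" and \<phi>: "\<phi> \<in> hom G A" and \<iota>: "\<iota> \<in> mon B A"
    and image: "\<phi> ` carrier G \<subseteq> \<iota> ` carrier B"
  obtains h where "h \<in> hom G B" and "\<forall>x\<in>carrier G. \<iota> (h x) = \<phi> x"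
proof -
  interpret G: group G by fact
  interpret B: group B by fact
  have \<iota>_hom: "\<iota> \<in> hom B A" and \<iota>_inj: "inj_on \<iota> (carrier B)" using \<iota> by (auto simp: mon_def)
  define h where "h x = inv_into (carrier B) \<iota> (\<phi> x)" for x
  have h_closed: "h x \<in> carrier B" if "x \<in> carrier G" for x
    unfolding h_def using image that by (intro inv_into_into) blast
  have \<iota>_h: "\<iota> (h x) = \<phi> x" if "x \<in> carrier G" for x
    unfolding h_def using image that by (intro f_inv_into_f) blast
  have "h \<in> hom G B"
  proof (rule homI)
    fix x y assume xy: "x \<in> carrier G" "y \<in> carrier G"
    have "\<iota> (h (x \<otimes>\<^bsub>G\<^esub> y)) = \<iota> (h x \<otimes>\<^bsub>B\<^esub> h y)"
      using xy by (simp add: \<iota>_h hom_mult[OF \<phi>] hom_mult[OF \<iota>_hom] h_closed)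
    then show "h (x \<otimes>\<^bsub>G\<^esub> y) = h x \<otimes>\<^bsub>B\<^esub> h y"
      using xy by (intro inj_onD[OF \<iota>_inj]) (simp_all add: h_closed)
  qed (rule h_closed)
  then show thesis by (rule that) (simp add: \<iota>_h)
qed

lemma (in group_hom) card_carrier_eq_card_image_times_card_kernel:
  assumes "finite (carrier G)"
  shows "card (carrier G) = card (h ` carrier G) * card (kernel G H h)"
proof (rule card_eq_card_image_times_fibre[OF assms])
  fix y assume "y \<in> h ` carrier G"
  then obtain x where x: "x \<in> carrier G" "y = h x" by blast
  have "bij_betw (\<lambda>z. x \<otimes> z) (kernel G H h) {z \<in> carrier G. h z = y}"
    using x by (intro bij_betw_byWitness[where f' = "\<lambda>z. inv x \<otimes> z"])
      (auto simp: kernel_def G.m_assoc[symmetric])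
  then show "card {z \<in> carrier G. h z = y} = card (kernel G H h)"
    by (simp add: bij_betw_same_card)
qed

lemma (in group_hom) hom_to_Mod:
  assumes "K \<lhd> H"
  shows "group_hom G (H Mod K) (\<lambda>x. K #>\<^bsub>H\<^esub> h x)"
proof -
  interpret K: normal K H by fact
  have "(\<lambda>x. K #>\<^bsub>H\<^esub> x) \<circ> h \<in> hom G (H Mod K)"
    using Group.hom_compose[OF homh K.r_coset_hom_Mod] .
  then show ?thesis
    by (intro group_hom.intro group_hom_axioms.intro K.factorgroup_is_group)
      (simp_all add: comp_def)
qed

context sym_cocycle
begin

text \<open>The elements of \<open>auto V\<close> are extensional functions, while \<open>f p\<close> is arbitrary outside of the carrier.\<close>

definition f_auto :: "(nat \<Rightarrow> nat) \<Rightarrow> 'a \<Rightarrow> 'a"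
  where "f_auto p = restrict (f p) (carrier V)"

lemma f_auto_in_auto:
  assumes p: "p permutes {1..n}"
  shows "f_auto p \<in> auto V"
proof -
  have "bij_betw (f_auto p) (carrier V) (carrier V)"
    using f_bij[OF p] by (rule bij_betw_cong[THEN iffD1, rotated]) (simp add: f_auto_def)
  moreover have "f_auto p \<in> hom V V"
    using p by (intro homI) (simp_all add: f_auto_def f_closed f_mult)
  ultimately show ?thesis by (simp add: auto_def Bij_def f_auto_def)
qed

lemma f_auto_hom: "group_hom (sym_group n) (AutoGroup V) f_auto"
proof (intro group_hom.intro group_hom_axioms.intro sym_group_is_group AutoGroup homI)
  show "f_auto p \<in> carrier (AutoGroup V)" if "p \<in> carrier (sym_group n)" for p
    using that f_auto_in_auto by (simp add: AutoGroup_def sym_group_carrier)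
  show "f_auto (p \<otimes>\<^bsub>sym_group n\<^esub> q) = f_auto p \<otimes>\<^bsub>AutoGroup V\<^esub> f_auto q"
    if "p \<in> carrier (sym_group n)" "q \<in> carrier (sym_group n)" for p q
    using that f_auto_in_auto
    by (subst auto_mult)
      (auto simp: sym_group_carrier sym_group_mult f_auto_def compose_def fun_eq_iff restrict_def
        f_comp f_closed)
qed

text \<open>The normal subgroups of \<open>S\<^sub>n\<close> distinguish the cases: the kernel of the map to \<open>OutGroup V\<close>, and then the kernel of \<open>f\<close>. When
\<open>f\<close> embeds \<open>A\<^sub>n\<close> into the inner automorphisms, the equation \<open>2 |A\<^sub>n| = |V| = |Inn V| |Z|\<close>, with \<open>Z\<close> the centre, leaves only
\<open>|Z| = 1\<close> and \<open>|Z| = 2\<close>.\<close>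

theorem sequence_or_embeds_Out:
  assumes n: "n \<ge> 5" and order: "order V = fact n"
  shows "fits_short_exact (alt_group n) V sign_img
    \<or> fits_short_exact sign_img V (alt_group n)
    \<or> embeds (sym_group n) (OutGroup V)"
proof -
  interpret F: group_hom "sym_group n" "AutoGroup V" f_auto by (rule f_auto_hom)
  interpret Inn: normal "inner_auto V" "AutoGroup V" by (rule inner_auto_normal)
  interpret Out: group_hom "sym_group n" "OutGroup V" "\<lambda>p. inner_auto V #>\<^bsub>AutoGroup V\<^esub> f_auto p"
    unfolding OutGroup_def by (rule F.hom_to_Mod[OF inner_auto_normal])
  let ?K = "kernel (sym_group n) (OutGroup V) (\<lambda>p. inner_auto V #>\<^bsub>AutoGroup V\<^esub> f_auto p)"
  have alt_order: "order V = 2 * card (carrier (alt_group n))"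
    using alt_group_card_carrier[of n] n order by simp
  have g_inj: "inj_on g {p. p permutes {1..n}}"
    using g_surj order card_permutations[of "{1..n}" n] finite_permutations[of "{1..n}"]
    by (intro eq_card_imp_inj_on) (auto simp: order_def)
  have alt_perm: "p permutes {1..n}" if "p \<in> carrier (alt_group n)" for p
    using that by (simp add: alt_group_carrier)
  show ?thesis
  proof (cases "?K = {id}")
    case True
    then have "inj_on (\<lambda>p. inner_auto V #>\<^bsub>AutoGroup V\<^esub> f_auto p) (carrier (sym_group n))"
      by (intro Out.trivial_ker_imp_inj) (simp add: sym_group_one)
    then have "embeds (sym_group n) (OutGroup V)"
      unfolding embeds_def mon_def using Out.homh by blast
    then show ?thesis by blast
  next
    case False
    then have "carrier (alt_group n) \<subseteq> ?K"
      by (rule normal_subgroup_contains_alt_group[OF n Out.normal_kernel])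
    then have f_inner: "f_auto p \<in> inner_auto V" if "p \<in> carrier (alt_group n)" for p
      using that F.H.rcos_self[OF F.hom_closed[of p] Inn.subgroup_axioms]
      by (auto simp: kernel_def OutGroup_def FactGroup_def subset_iff)
    show ?thesis
    proof (cases "linear_kernel = {id}")
      case False
      then have ker: "carrier (alt_group n) \<subseteq> linear_kernel"
        by (rule normal_subgroup_contains_alt_group[OF n linear_kernel_normal])
      have "g \<in> mon (alt_group n) V"
        unfolding mon_def
      proof (intro CollectI conjI homI)
        show "inj_on g (carrier (alt_group n))"
          by (rule inj_on_subset[OF g_inj]) (auto dest: alt_perm)
        fix p q assume pq: "p \<in> carrier (alt_group n)" "q \<in> carrier (alt_group n)"
        then have "p \<in> linear_kernel" using ker by blast
        then show "g (p \<otimes>\<^bsub>alt_group n\<^esub> q) = g p \<otimes> g q"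
          using alt_perm[OF pq(2)] by (simp add: alt_group_mult g_comp linear_kernel_def g_closed)
      qed (rule g_closed[OF alt_perm])
      then show ?thesis
        using index_two_fits_short_exact[OF finite_carrier _ alt_group_is_group alt_order] by blast
    next
      case True
      have f_auto_inj: "inj_on f_auto (carrier (sym_group n))"
      proof (rule F.trivial_ker_imp_inj)
        have "kernel (sym_group n) (AutoGroup V) f_auto \<subseteq> linear_kernel"
          by (auto simp: kernel_def linear_kernel_def sym_group_carrier AutoGroup_def BijGroup_def
              f_auto_def fun_eq_iff restrict_def split: if_splits)
        then show "kernel (sym_group n) (AutoGroup V) f_auto = {\<one>\<^bsub>sym_group n\<^esub>}"
          using True subgroup.one_closed[OF F.subgroup_kernel] by (auto simp: sym_group_one)
      qed
      interpret inner: group_hom V "AutoGroup V" "inner V"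
        by (intro group_hom.intro group_hom_axioms.intro is_group AutoGroup inner_hom)
      define Z where "Z = kernel V (AutoGroup V) (inner V)"
      have Z: "subgroup Z V" unfolding Z_def by (rule inner.subgroup_kernel)
      have alt_sub: "carrier (alt_group n) \<subseteq> carrier (sym_group n)"
        using alt_perm sym_group_carrier by blast

      have f_alt_inj: "inj_on f_auto (carrier (alt_group n))"
        by (rule inj_on_subset[OF f_auto_inj alt_sub])
      have f_alt_hom: "f_auto \<in> hom (alt_group n) (AutoGroup V)"
      proof (rule homI)
        fix p q assume "p \<in> carrier (alt_group n)" "q \<in> carrier (alt_group n)"
        then show "f_auto (p \<otimes>\<^bsub>alt_group n\<^esub> q) = f_auto p \<otimes>\<^bsub>AutoGroup V\<^esub> f_auto q"
          using F.hom_mult[of p q] alt_sub by (simp add: alt_group_mult sym_group_mult subset_iff)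
      qed (use F.hom_closed alt_sub in blast)
      have image_sub: "f_auto ` carrier (alt_group n) \<subseteq> inner V ` carrier V"
        using f_inner by (auto simp: inner_auto_def)
      have inner_eq: "inner V ` carrier V = inner_auto V" by (simp add: inner_auto_def)
      have order_eq: "2 * card (carrier (alt_group n)) = card (inner_auto V) * card Z"
        using inner.card_carrier_eq_card_image_times_card_kernel[OF finite_carrier] alt_order
        by (simp add: order_def Z_def inner_eq)
      have fin_inner: "finite (inner_auto V)"
        using finite_carrier by (simp add: inner_auto_def)
      have image_subgroup: "subgroup (f_auto ` carrier (alt_group n)) (AutoGroup V)"
        by (rule F.subgroup_img_is_subgroup[OF alt_group_is_subgroup])
      have "card (carrier (alt_group n)) dvd card (inner_auto V)"
      proof -
        interpret Inner: group "AutoGroup V\<lparr>carrier := inner_auto V\<rparr>"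
          using F.H.subgroup_imp_group[OF Inn.subgroup_axioms] .
        have "subgroup (f_auto ` carrier (alt_group n)) (AutoGroup V\<lparr>carrier := inner_auto V\<rparr>)"
          using image_sub by (intro F.H.subgroup_incl image_subgroup Inn.subgroup_axioms)
            (simp add: inner_eq)
        from Inner.lagrange[OF this]
        have "card (inner_auto V) = card (f_auto ` carrier (alt_group n))
            * card (rcosets\<^bsub>AutoGroup V\<lparr>carrier := inner_auto V\<rparr>\<^esub> (f_auto ` carrier (alt_group n)))"
          by (simp add: order_def mult.commute)
        then have "card (f_auto ` carrier (alt_group n)) dvd card (inner_auto V)" by (rule dvdI)
        then show ?thesis by (simp only: card_image[OF f_alt_inj])
      qed
      then obtain k where k: "card (inner_auto V) = card (carrier (alt_group n)) * k"
        by (elim dvdE)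
      have "card (carrier (alt_group n)) > 0"
        using alt_order order by (cases "card (carrier (alt_group n))") auto
      then have "k * card Z = 2" using order_eq k by simp
      moreover have "card Z dvd 2" unfolding calculation[symmetric] by (rule dvd_triv_right)
      then have "card Z = 1 \<or> card Z = 2" using two_is_prime_nat unfolding prime_nat_iff by simp
      ultimately consider "card Z = 1" | "card Z = 2" "k = 1" by auto
      then show ?thesis
      proof cases
        case 1
        then obtain z where "Z = {z}" by (rule card_1_singletonE)
        then have "Z = {\<one>}" using subgroup.one_closed[OF Z] by simp
        then have inner_mon: "inner V \<in> mon V (AutoGroup V)"
          unfolding mon_def Z_def by (intro CollectI conjI inner_hom inner.trivial_ker_imp_inj)
        obtain h where h: "h \<in> hom (alt_group n) V"
          "\<forall>p\<in>carrier (alt_group n). inner V (h p) = f_auto p"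
          using hom_factor_through_mon[OF alt_group_is_group is_group f_alt_hom inner_mon image_sub] .
        have "inj_on h (carrier (alt_group n))"
        proof (rule inj_onI)
          fix p q assume pq: "p \<in> carrier (alt_group n)" "q \<in> carrier (alt_group n)" "h p = h q"
          then have "f_auto p = f_auto q" using bspec[OF h(2) pq(1)] bspec[OF h(2) pq(2)] by simp
          then show "p = q" using pq(1,2) by (rule inj_onD[OF f_alt_inj])
        qed
        then have "h \<in> mon (alt_group n) V" using h(1) by (simp add: mon_def)
        then show ?thesis
          using index_two_fits_short_exact[OF finite_carrier _ alt_group_is_group alt_order] by simp
      next
        case 2
        have f_mon: "f_auto \<in> mon (alt_group n) (AutoGroup V)"
          using f_alt_hom f_alt_inj by (simp add: mon_def)
        have image_eq: "f_auto ` carrier (alt_group n) = inner V ` carrier V"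
          using 2(2) k image_sub fin_inner f_alt_inj
          by (intro card_subset_eq) (simp_all add: inner_eq card_image)
        obtain h where h: "h \<in> hom V (alt_group n)"
          "\<forall>x\<in>carrier V. f_auto (h x) = inner V x"
          using hom_factor_through_mon[OF is_group alt_group_is_group inner_hom f_mon
              eq_refl[OF image_eq[symmetric]]] .
        have h_closed: "h x \<in> carrier (alt_group n)" if "x \<in> carrier V" for x
          using hom_in_carrier[OF h(1) that] .
        have "h ` carrier V = carrier (alt_group n)"
        proof (intro equalityI subsetI)
          fix p assume p: "p \<in> carrier (alt_group n)"
          then have "f_auto p \<in> inner V ` carrier V" using subsetD[OF image_sub] by simp
          then obtain x where x: "x \<in> carrier V" "f_auto p = inner V x" by (elim imageE)
          then have "p = h x"
            using bspec[OF h(2) x(1)] p h_closed[OF x(1)] by (intro inj_onD[OF f_alt_inj]) simp_all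
          then show "p \<in> h ` carrier V" using x(1) by (rule image_eqI)
        qed (use h_closed in auto)
        then have "h \<in> epi V (alt_group n)" using h(1) by (simp add: epi_def)
        moreover have "kernel V (alt_group n) h = Z"
        proof -
          have "h x = \<one>\<^bsub>alt_group n\<^esub> \<longleftrightarrow> inner V x = \<one>\<^bsub>AutoGroup V\<^esub>" if x: "x \<in> carrier V" for x
          proof -
            have "f_auto \<one>\<^bsub>alt_group n\<^esub> = \<one>\<^bsub>AutoGroup V\<^esub>"
              using F.hom_one by (simp add: alt_group_one sym_group_one)
            then show ?thesis
              using bspec[OF h(2) x] inj_on_eq_iff[OF f_alt_inj h_closed[OF x], of "\<one>\<^bsub>alt_group n\<^esub>"]
                monoid.one_closed[OF group.is_monoid[OF alt_group_is_group], of n] by simp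
          qed
          then show ?thesis unfolding Z_def kernel_def by (intro Collect_cong) auto
        qed
        moreover obtain s where s: "s \<in> mon sign_img V" "s ` carrier sign_img = Z"
        proof -
          obtain s where "s \<in> iso sign_img (V\<lparr>carrier := Z\<rparr>)"
            using order_two_iso_sign_img(2)[OF subgroup_imp_group[OF Z]] 2(1)
            by (auto simp: order_def)
          then show thesis
            using subgroup.subset[OF Z]
            by (intro that[of s]) (auto simp: iso_def mon_def hom_def bij_betw_def)
        qed
        ultimately have "fits_short_exact sign_img V (alt_group n)"
          unfolding fits_short_exact_def by (intro exI[of _ s] exI[of _ h]) simp
        then show ?thesis by blast
      qed
    qed
  qed
qed

end

section \<open>Characteristic quotients and regular subgroups\<close>

lemma (in group) characteristic_imp_normal:
  assumes "characteristic M G"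
  shows "M \<lhd> G"
proof (rule normal_invI)
  show sub: "subgroup M G" using assms by (simp add: characteristic_def)
  fix x h assume xh: "h \<in> M" "x \<in> carrier G"
  have "h \<in> carrier G" using subgroup.mem_carrier[OF sub xh(1)] .
  then have "x \<otimes> h \<otimes> inv x = inner G x h" by simp
  also have "\<dots> \<in> inner G x ` M" using xh(1) by (rule imageI)
  also have "inner G x ` M = M"
    using assms inner_in_auto[OF xh(2)] unfolding characteristic_def by blast
  finally show "x \<otimes> h \<otimes> inv x \<in> M" .
qed

lemma (in sym_cocycle) quotient_cocycle:
  assumes M: "characteristic M V"
  shows "sym_cocycle (V Mod M) n (\<lambda>p C. f p ` C) (\<lambda>p. M #> g p)"
proof -
  interpret M: normal M V by (rule characteristic_imp_normal[OF M])
  have M_sub: "M \<subseteq> carrier V" by (rule M.subset)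
  have f_M: "f p ` M = M" if "p permutes {1..n}" for p
  proof -
    have "f_auto p ` M = M" using M f_auto_in_auto[OF that] by (simp add: characteristic_def)
    moreover have "f_auto p ` M = f p ` M"
      using M_sub by (intro image_cong) (auto simp: f_auto_def)
    ultimately show ?thesis by simp
  qed
  have f_coset: "f p ` (M #> v) = M #> f p v" if "p permutes {1..n}" "v \<in> carrier V" for p v
    using coset_hom(2)[OF f_hom[OF that(1)] M_sub that(2)] f_M[OF that(1)] by simp
  show ?thesis
  proof (intro sym_cocycle.intro M.factorgroup_is_group sym_cocycle_axioms.intro)
    fix p assume p: "p permutes {1..n}"
    show "(\<lambda>C. f p ` C) \<in> hom (V Mod M) (V Mod M)"
    proof (rule homI)
      fix C assume "C \<in> carrier (V Mod M)"
      then obtain v where v: "v \<in> carrier V" "C = M #> v" by (auto simp: carrier_FactGroup)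
      then show "f p ` C \<in> carrier (V Mod M)"
        using f_coset[OF p v(1)] f_closed[OF p v(1)] by (auto simp: carrier_FactGroup)
    next
      fix C D assume "C \<in> carrier (V Mod M)" "D \<in> carrier (V Mod M)"
      then have "C \<subseteq> carrier V" "D \<subseteq> carrier V"
        using r_coset_subset_G[OF M_sub] by (auto simp: carrier_FactGroup)
      then show "f p ` (C \<otimes>\<^bsub>V Mod M\<^esub> D) = f p ` C \<otimes>\<^bsub>V Mod M\<^esub> f p ` D"
        using set_mult_hom[OF f_hom[OF p]] by simp
    qed
    fix q assume q: "q permutes {1..n}"
    show "M #> g (p \<circ> q) = (M #> g p) \<otimes>\<^bsub>V Mod M\<^esub> f p ` (M #> g q)"
      using p q by (simp only: g_comp f_coset g_closed f_closed mult_FactGroup M.rcos_sum)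
  next
    show "(\<lambda>p. M #> g p) ` {p. p permutes {1..n}} = carrier (V Mod M)"
      by (simp only: carrier_FactGroup g_surj[symmetric] image_image)
  qed
qed

text \<open>Let \<open>\<epsilon> \<sigma>\<close> be the element of the regular subgroup \<open>R\<close> that sends \<open>\<one>\<close> to \<open>\<sigma>\<close>, and let \<open>c \<sigma>\<close> be conjugation by \<open>\<lambda>(\<sigma>)\<close>.
Both \<open>\<epsilon> (\<sigma> \<tau>)\<close> and \<open>c \<sigma> (\<epsilon> \<tau>) \<epsilon> \<sigma>\<close> lie in \<open>R\<close> and send \<open>\<one>\<close> to \<open>\<sigma> \<tau>\<close>, so they are equal. The factors appear
in the wrong order for a crossed homomorphism; passing to the inverses \<open>\<rho> \<sigma>\<close> of \<open>\<epsilon> \<sigma>\<close> corrects this.\<close>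

lemma regular_subgroup_imp_cocycle:
  assumes "group G" "group N" and e: "num_regular G N \<ge> 1"
  obtains f g where "\<forall>\<sigma>\<in>carrier G. f \<sigma> \<in> hom N N"
    and "\<forall>\<sigma>\<in>carrier G. \<forall>\<tau>\<in>carrier G. g (\<sigma> \<otimes>\<^bsub>G\<^esub> \<tau>) = g \<sigma> \<otimes>\<^bsub>N\<^esub> f \<sigma> (g \<tau>)"
    and "bij_betw g (carrier G) (carrier N)"
proof -
  interpret G: group G by fact
  interpret N: group N by fact
  define S where "S = carrier G"
  define B where "B = BijGroup S"
  interpret B: group B unfolding B_def by (rule group_BijGroup)
  have B_carrier: "carrier B = Bij S" by (simp add: B_def BijGroup_def)
  define L where "L = left_regular G"
  have "{R. regular_subgroup R G \<and> B\<lparr>carrier := R\<rparr> \<cong> N \<and> L ` S \<subseteq> normalizer B R} \<noteq> {}"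
    using e unfolding num_regular_def B_def S_def L_def by (intro notI) simp
  then obtain R where R: "regular_subgroup R G" "B\<lparr>carrier := R\<rparr> \<cong> N" "L ` S \<subseteq> normalizer B R"
    by blast
  have R_sub: "subgroup R B" and R_bij: "bij_betw (\<lambda>\<eta>. \<eta> \<one>\<^bsub>G\<^esub>) R S"
    using R(1) by (simp_all add: regular_subgroup_def B_def S_def)
  have R_B: "R \<subseteq> carrier B" using subgroup.subset[OF R_sub] .
  interpret R: group "B\<lparr>carrier := R\<rparr>" using B.subgroup_imp_group[OF R_sub] .
  obtain \<psi> where \<psi>: "\<psi> \<in> iso (B\<lparr>carrier := R\<rparr>) N" using R(2) by (auto simp: is_iso_def)
  define \<psi>' where "\<psi>' = inv_into R \<psi>"
  have \<psi>': "\<psi>' \<in> iso N (B\<lparr>carrier := R\<rparr>)"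
    using R.iso_set_sym[OF \<psi>] by (simp add: \<psi>'_def)
  have \<psi>_bij: "bij_betw \<psi> R (carrier N)" using \<psi> by (simp add: iso_def)
  have \<psi>_mult: "\<psi> (a \<otimes>\<^bsub>B\<^esub> b) = \<psi> a \<otimes>\<^bsub>N\<^esub> \<psi> b" if "a \<in> R" "b \<in> R" for a b
    using \<psi> that by (auto simp: iso_def hom_def)
  have \<psi>_closed: "\<psi> a \<in> carrier N" if "a \<in> R" for a
    using \<psi>_bij that by (auto simp: bij_betw_def)
  have \<psi>'_mult: "\<psi>' (x \<otimes>\<^bsub>N\<^esub> y) = \<psi>' x \<otimes>\<^bsub>B\<^esub> \<psi>' y" if "x \<in> carrier N" "y \<in> carrier N" for x y
    using \<psi>' that by (auto simp: iso_def hom_def)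
  have \<psi>'_closed: "\<psi>' x \<in> R" if "x \<in> carrier N" for x
    using \<psi>' that by (auto simp: iso_def hom_def)
  have \<psi>'_\<psi>: "\<psi>' (\<psi> a) = a" if "a \<in> R" for a
    using \<psi>_bij that by (simp add: \<psi>'_def bij_betw_inv_into_left)
  have eval: "(a \<otimes>\<^bsub>B\<^esub> b) x = a (b x)" if "a \<in> carrier B" "b \<in> carrier B" "x \<in> S" for a b x
    using that by (simp add: B_def BijGroup_def compose_def)
  have maps: "a x \<in> S" if "a \<in> carrier B" "x \<in> S" for a x
    using that Bij_imp_funcset[of a S] by (auto simp: B_carrier)
  have eval_inv: "(inv\<^bsub>B\<^esub> a) (a x) = x" if "a \<in> carrier B" "x \<in> S" for a x
  proof -
    have "(inv\<^bsub>B\<^esub> a) (a x) = (inv\<^bsub>B\<^esub> a \<otimes>\<^bsub>B\<^esub> a) x"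
      using that by (intro eval[symmetric]) simp_all
    also have "\<dots> = \<one>\<^bsub>B\<^esub> x" using that by simp
    also have "\<dots> = x" using that(2) by (simp add: B_def BijGroup_def)
    finally show ?thesis .
  qed
  have L_closed: "L \<sigma> \<in> carrier B" if "\<sigma> \<in> S" for \<sigma>
  proof -
    have "bij_betw (L \<sigma>) S S"
      using that unfolding L_def left_regular_def S_def
      by (intro bij_betw_byWitness[where f' = "\<lambda>x. inv\<^bsub>G\<^esub> \<sigma> \<otimes>\<^bsub>G\<^esub> x"])
        (auto simp: G.m_assoc[symmetric])
    then show ?thesis by (simp add: B_carrier Bij_def L_def left_regular_def S_def)
  qed
  have L_eval: "L \<sigma> \<tau> = \<sigma> \<otimes>\<^bsub>G\<^esub> \<tau>" if "\<tau> \<in> S" for \<sigma> \<tau>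
    using that by (simp add: L_def left_regular_def S_def)
  define c where "c \<sigma> \<eta> = L \<sigma> \<otimes>\<^bsub>B\<^esub> \<eta> \<otimes>\<^bsub>B\<^esub> inv\<^bsub>B\<^esub> (L \<sigma>)" for \<sigma> \<eta>
  have c_closed: "c \<sigma> \<eta> \<in> R" if "\<sigma> \<in> S" "\<eta> \<in> R" for \<sigma> \<eta>
  proof -
    have "L \<sigma> \<in> normalizer B R" using R(3) that(1) by blast
    then have "L \<sigma> <#\<^bsub>B\<^esub> R #>\<^bsub>B\<^esub> inv\<^bsub>B\<^esub> (L \<sigma>) = R"
      using R_B by (simp add: normalizer_def stabilizer_def)
    moreover have "c \<sigma> \<eta> \<in> L \<sigma> <#\<^bsub>B\<^esub> R #>\<^bsub>B\<^esub> inv\<^bsub>B\<^esub> (L \<sigma>)"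
      using that(2) by (auto simp: c_def l_coset_def r_coset_def)
    ultimately show ?thesis by simp
  qed
  have c_mult: "c \<sigma> (a \<otimes>\<^bsub>B\<^esub> b) = c \<sigma> a \<otimes>\<^bsub>B\<^esub> c \<sigma> b" if "\<sigma> \<in> S" "a \<in> R" "b \<in> R" for \<sigma> a b
  proof -
    have ab: "a \<in> carrier B" "b \<in> carrier B" using that R_B by blast+
    have "inv\<^bsub>B\<^esub> (L \<sigma>) \<otimes>\<^bsub>B\<^esub> (L \<sigma> \<otimes>\<^bsub>B\<^esub> x) = x" if "x \<in> carrier B" for x
      using that L_closed[OF \<open>\<sigma> \<in> S\<close>] by (simp add: B.m_assoc[symmetric])
    then show ?thesis using ab L_closed[OF that(1)] by (simp add: c_def B.m_assoc)
  qed
  have c_inv: "c \<sigma> (inv\<^bsub>B\<^esub> a) = inv\<^bsub>B\<^esub> (c \<sigma> a)" if "\<sigma> \<in> S" "a \<in> R" for \<sigma> a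
  proof -
    have a: "a \<in> carrier B" using that R_B by blast
    then show ?thesis
      using L_closed[OF that(1)] by (simp add: c_def B.inv_mult_group B.m_assoc)
  qed
  define \<epsilon> where "\<epsilon> = inv_into R (\<lambda>\<eta>. \<eta> \<one>\<^bsub>G\<^esub>)"
  have \<epsilon>_bij: "bij_betw \<epsilon> S R" unfolding \<epsilon>_def by (rule bij_betw_inv_into[OF R_bij])
  have \<epsilon>_closed: "\<epsilon> \<sigma> \<in> R" if "\<sigma> \<in> S" for \<sigma>
    using \<epsilon>_bij that by (auto simp: bij_betw_def)
  have \<epsilon>_one: "\<epsilon> \<sigma> \<one>\<^bsub>G\<^esub> = \<sigma>" if "\<sigma> \<in> S" for \<sigma>
    using bij_betw_inv_into_right[OF R_bij that] by (simp add: \<epsilon>_def)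
  have one_S: "\<one>\<^bsub>G\<^esub> \<in> S" by (simp add: S_def)
  have \<epsilon>_mult: "\<epsilon> (\<sigma> \<otimes>\<^bsub>G\<^esub> \<tau>) = c \<sigma> (\<epsilon> \<tau>) \<otimes>\<^bsub>B\<^esub> \<epsilon> \<sigma>" if \<sigma>: "\<sigma> \<in> S" and \<tau>: "\<tau> \<in> S" for \<sigma> \<tau>
  proof -
    have \<sigma>\<tau>: "\<sigma> \<otimes>\<^bsub>G\<^esub> \<tau> \<in> S" using \<sigma> \<tau> by (simp add: S_def)
    have L\<sigma>: "L \<sigma> \<in> carrier B" using L_closed[OF \<sigma>] .
    have "L \<sigma> \<one>\<^bsub>G\<^esub> = \<sigma>" using L_eval[OF one_S, of \<sigma>] \<sigma> by (simp add: S_def)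
    then have inv_L: "(inv\<^bsub>B\<^esub> (L \<sigma>)) \<sigma> = \<one>\<^bsub>G\<^esub>" using eval_inv[OF L\<sigma> one_S] by simp
    have \<epsilon>B: "\<epsilon> \<sigma> \<in> carrier B" "\<epsilon> \<tau> \<in> carrier B" "c \<sigma> (\<epsilon> \<tau>) \<in> carrier B"
      using \<epsilon>_closed c_closed \<sigma> \<tau> R_B by blast+
    have "(c \<sigma> (\<epsilon> \<tau>) \<otimes>\<^bsub>B\<^esub> \<epsilon> \<sigma>) \<one>\<^bsub>G\<^esub> = c \<sigma> (\<epsilon> \<tau>) \<sigma>"
      using \<epsilon>B one_S \<epsilon>_one[OF \<sigma>] by (simp add: eval)
    also have "\<dots> = L \<sigma> (\<epsilon> \<tau> \<one>\<^bsub>G\<^esub>)"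
      using \<epsilon>B L\<sigma> \<sigma> inv_L one_S by (simp add: c_def eval maps)
    also have "\<dots> = \<sigma> \<otimes>\<^bsub>G\<^esub> \<tau>" by (simp add: \<epsilon>_one[OF \<tau>] L_eval[OF \<tau>])
    finally have eq: "(c \<sigma> (\<epsilon> \<tau>) \<otimes>\<^bsub>B\<^esub> \<epsilon> \<sigma>) \<one>\<^bsub>G\<^esub> = \<sigma> \<otimes>\<^bsub>G\<^esub> \<tau>" .
    have "c \<sigma> (\<epsilon> \<tau>) \<otimes>\<^bsub>B\<^esub> \<epsilon> \<sigma> \<in> R"
      using subgroup.m_closed[OF R_sub c_closed[OF \<sigma> \<epsilon>_closed[OF \<tau>]] \<epsilon>_closed[OF \<sigma>]] .
    then have "\<epsilon> ((c \<sigma> (\<epsilon> \<tau>) \<otimes>\<^bsub>B\<^esub> \<epsilon> \<sigma>) \<one>\<^bsub>G\<^esub>) = c \<sigma> (\<epsilon> \<tau>) \<otimes>\<^bsub>B\<^esub> \<epsilon> \<sigma>"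
      unfolding \<epsilon>_def using bij_betw_inv_into_left[OF R_bij] by blast
    then show ?thesis unfolding eq .
  qed
  define \<rho> where "\<rho> \<sigma> = inv\<^bsub>B\<^esub> (\<epsilon> \<sigma>)" for \<sigma>
  have \<rho>_closed: "\<rho> \<sigma> \<in> R" if "\<sigma> \<in> S" for \<sigma>
    unfolding \<rho>_def using subgroup.m_inv_closed[OF R_sub \<epsilon>_closed[OF that]] .
  have \<rho>_mult: "\<rho> (\<sigma> \<otimes>\<^bsub>G\<^esub> \<tau>) = \<rho> \<sigma> \<otimes>\<^bsub>B\<^esub> c \<sigma> (\<rho> \<tau>)" if \<sigma>: "\<sigma> \<in> S" and \<tau>: "\<tau> \<in> S" for \<sigma> \<tau>
  proof -
    have "\<epsilon> \<sigma> \<in> carrier B" "c \<sigma> (\<epsilon> \<tau>) \<in> carrier B"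
      using \<epsilon>_closed c_closed \<sigma> \<tau> R_B by blast+
    then show ?thesis
      by (simp add: \<rho>_def \<epsilon>_mult[OF \<sigma> \<tau>] B.inv_mult_group c_inv[OF \<sigma> \<epsilon>_closed[OF \<tau>]])
  qed
  have \<rho>_bij: "bij_betw \<rho> S R"
  proof -
    have "bij_betw (\<lambda>\<eta>. inv\<^bsub>B\<^esub> \<eta>) R R"
      using R_B subgroup.m_inv_closed[OF R_sub]
      by (intro bij_betw_byWitness[where f' = "\<lambda>\<eta>. inv\<^bsub>B\<^esub> \<eta>"]) (auto simp: subset_iff)
    from bij_betw_trans[OF \<epsilon>_bij this] show ?thesis by (simp add: \<rho>_def[abs_def] comp_def)
  qed
  define f where "f \<sigma> x = \<psi> (c \<sigma> (\<psi>' x))" for \<sigma> x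
  define g where "g \<sigma> = \<psi> (\<rho> \<sigma>)" for \<sigma>
  show thesis
  proof (rule that[of f g]; (intro ballI)?)
    fix \<sigma> assume \<sigma>: "\<sigma> \<in> carrier G"
    then have \<sigma>S: "\<sigma> \<in> S" by (simp add: S_def)
    show "f \<sigma> \<in> hom N N"
    proof (rule homI)
      fix x y assume xy: "x \<in> carrier N" "y \<in> carrier N"
      then show "f \<sigma> (x \<otimes>\<^bsub>N\<^esub> y) = f \<sigma> x \<otimes>\<^bsub>N\<^esub> f \<sigma> y"
        by (simp add: f_def \<psi>'_mult c_mult[OF \<sigma>S] \<psi>_mult \<psi>'_closed c_closed[OF \<sigma>S])
    qed (simp add: f_def \<psi>_closed c_closed[OF \<sigma>S] \<psi>'_closed)
    fix \<tau> assume "\<tau> \<in> carrier G"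
    then have \<tau>S: "\<tau> \<in> S" by (simp add: S_def)
    show "g (\<sigma> \<otimes>\<^bsub>G\<^esub> \<tau>) = g \<sigma> \<otimes>\<^bsub>N\<^esub> f \<sigma> (g \<tau>)"
      by (simp add: g_def f_def \<rho>_mult[OF \<sigma>S \<tau>S] \<psi>_mult \<rho>_closed[OF \<sigma>S] \<rho>_closed[OF \<tau>S]
          c_closed[OF \<sigma>S] \<psi>'_\<psi>)
  next
    show "bij_betw g (carrier G) (carrier N)"
      using bij_betw_trans[OF \<rho>_bij \<psi>_bij] by (simp add: g_def[abs_def] comp_def S_def)
  qed
qed

text \<open>The two halves are \<open>sequence_or_embeds_Out\<close> for \<open>N\<close> and \<open>abelian_cocycle_card_le_2\<close> for the crossed homomorphism
that is induced on \<open>N Mod M\<close>.\<close>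

theorem theorem1p7:
  fixes n :: nat and N :: "('a, 'b) monoid_scheme"
  assumes "n \<ge> 5"
    and "group N"
    and "order N = fact n"
    and "num_regular (sym_group n) N \<ge> 1"
  shows "(fits_short_exact (alt_group n) N sign_img
          \<or> fits_short_exact sign_img N (alt_group n)
          \<or> embeds (sym_group n) (OutGroup N))
        \<and> (\<forall>M. maximal_characteristic M N \<longrightarrow>
              \<not> comm_group (N Mod M) \<or> N Mod M \<cong> sign_img)"
proof -
  obtain f g where f: "\<forall>\<sigma>\<in>carrier (sym_group n). f \<sigma> \<in> hom N N"
    and g: "\<forall>\<sigma>\<in>carrier (sym_group n). \<forall>\<tau>\<in>carrier (sym_group n).
      g (\<sigma> \<otimes>\<^bsub>sym_group n\<^esub> \<tau>) = g \<sigma> \<otimes>\<^bsub>N\<^esub> f \<sigma> (g \<tau>)"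
    and bij: "bij_betw g (carrier (sym_group n)) (carrier N)"
    using regular_subgroup_imp_cocycle[OF sym_group_is_group assms(2,4)] .
  have "sym_cocycle N n f g"
  proof (intro sym_cocycle.intro assms(2) sym_cocycle_axioms.intro)
    show "g ` {p. p permutes {1..n}} = carrier N"
      using bij by (simp add: bij_betw_def sym_group_def)
  qed (use f g in \<open>simp_all add: sym_group_def\<close>)
  then interpret sym_cocycle N n f g .
  have "N Mod M \<cong> sign_img" if M: "maximal_characteristic M N" and comm: "comm_group (N Mod M)" for M
  proof -
    have char: "characteristic M N" and proper: "M \<noteq> carrier N"
      using M by (simp_all add: maximal_characteristic_def)
    interpret M: normal M N by (rule characteristic_imp_normal[OF char])
    interpret Q: sym_cocycle "N Mod M" n "\<lambda>p C. f p ` C" "\<lambda>p. M #>\<^bsub>N\<^esub> g p"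
      by (rule quotient_cocycle[OF char])
    have "order (N Mod M) \<le> 2"
      using abelian_cocycle_card_le_2[OF assms(1) Q.sym_cocycle_axioms comm] by (simp add: order_def)
    moreover have "order (N Mod M) \<noteq> 0"
      using Q.finite_carrier Q.one_closed by (auto simp: order_def)
    moreover have "order (N Mod M) \<noteq> 1"
      using M.fact_group_trivial_iff[OF finite_carrier] Q.order_one_triv_iff proper
      by simp
    ultimately have "order (N Mod M) = 2" by linarith
    then show ?thesis by (rule order_two_iso_sign_img(1)[OF Q.is_group])
  qed
  then show ?thesis
    using sequence_or_embeds_Out[OF assms(1,3)] by blast
qed

end
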